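(* Let $\beta\in\mathbb{R}^d$ be the true regression parameter of the Cox proportional hazards model described in the context, let $m\ge1$ be a fixed integer, and let $\Sigma_P$ and $\Sigma$ be the $d\times d$ matrices defined in the context. Assume: (i) $\mathrm{pr}\{\sup_{t\in[0,\tau]}|Z(t)|\le c\}=1$; (ii) the baseline hazard function $\lambda_0(t)$ is bounded away from $0$ and infinity on $[0,\tau]$ and has continuous second derivative; (iii) $\mathrm{pr}\{Y(t)=1\}>0$ for all $t\in[0,\tau]$; (iv) $\Sigma_P$ and $\Sigma$ are positive definite; (v) for any $\phi\in C^\infty(B_c)$, $E[\phi\{Z(t)\}Y(t)]$, as a function of $t$ on $[0,\tau]$, has continuous second derivative; (vi) for any $\phi\in C^\infty(B_c)$, the process $n^{-1/2}\sum_{i=1}^n\big(\phi\{Z_i(t)\}Y_i(t)-E[\phi\{Z(t)\}Y(t)]\big)$, as a process in $t$, converges to a Gaussian process on $[0,\tau]$ as $n\to\infty$. Then $\Sigma_P^{-1}\ge\Sigma^{-1}$ (that is, $\Sigma_P^{-1}-\Sigma^{-1}$ is nonnegative definite), and equality $\Sigma_P^{-1}=\Sigma^{-1}$ holds if and only if $\beta=0$.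
   Context: Notation: $v^{\otimes 2}=vv'$ for $v\in\mathbb{R}^d$; $|\cdot|$ of a vector is the sum of the absolute values of its elements; $I$ is the indicator function. $c>0$ is a large but fixed constant, $B_c$ is the closed ball in $\mathbb{R}^d$ centered at the origin with radius $c$, and $C^\infty(B_c)$ is the set of all infinitely differentiable functions on $B_c$. Model. $T$ is a life time, $C$ a censoring time, $Z(\cdot)$ a $d$-dimensional covariate process, pathwise left continuous with right limits. $T$ and $C$ are conditionally independent given $Z$, and the conditional hazard of $T$ given $Z=z$ is $\lambda_0(t)\exp\{\beta'z(t)\}$ with baseline hazard function $\lambda_0$. Let $Y=\min(T,C)$, $Y(t)=I(Y\ge t)$, and $\tau=\sup\{t:\mathrm{pr}(Y>t)>0\}$. $(T_i,C_i,Z_i(\cdot),Y_i,Y_i(\cdot))$, $i=1,2,\dots$, are i.i.d. copies. The integer $m$ is the number of controls sampled at each failure time in a nested case-control design. Matrices. Let $\mu(t)=E[Z(t)\exp\{\beta'Z(t)\}Y(t)]/E[\exp\{\beta'Z(t)\}Y(t)]$ and $\Sigma_P=\Sigma_C-\Sigma_a$, where $$\Sigma_C=\int_0^\tau E[\{Z(t)-\mu(t)\}^{\otimes 2}\exp\{\beta'Z(t)\}Y(t)]\lambda_0(t)\,dt,$$ $$\Sigma_a=\frac1{m+1}\int_0^\tau E\left(\frac{[\sum_{j=1}^{m+1}\{Z_j(t)-\mu(t)\}\exp\{\beta'Z_j(t)\}]^{\otimes 2}}{\sum_{j=1}^{m+1}\exp\{\beta'Z_j(t)\}}\,\Big|\,Y_1\ge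 t,\dots,Y_{m+1}\ge t\right)\mathrm{pr}(Y\ge t)\lambda_0(t)\,dt.$$ ($\Sigma_P^{-1}$ is the asymptotic variance of Thomas' partial likelihood estimator.) Let $b(t)=E[\exp\{\beta'Z(t)\}\mid Y\ge t]$, $$\tilde w(t)=\frac{m\,b(t)}{\exp\{\beta'Z(t)\}+m\,b(t)},\qquad g(t)=\frac{E[\tilde w(t)Z(t)\exp\{\beta'Z(t)\}Y(t)]}{E[\tilde w(t)\exp\{\beta'Z(t)\}Y(t)]},$$ and $$\Sigma=\int_0^\tau E\big[\tilde w(t)\{Z(t)-g(t)\}^{\otimes 2}\exp\{\beta'Z(t)\}Y(t)\big]\lambda_0(t)\,dt.$$ *)

theory Defs
  imports "HOL-Probability.Probability"
begin

section \<open>Vectors, matrices, smooth functions\<close>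

definition norm1 :: "real ^ 'd \<Rightarrow> real" where
  "norm1 v = (\<Sum>i\<in>UNIV. \<bar>v $ i\<bar>)"

definition outer2 :: "real ^ 'd \<Rightarrow> real ^ 'd ^ 'd" where
  "outer2 v = (\<chi> i j. v $ i * v $ j)"

definition pos_def :: "real ^ 'd ^ 'd \<Rightarrow> bool" where
  "pos_def A \<longleftrightarrow> transpose A = A \<and> (\<forall>x. x \<noteq> 0 \<longrightarrow> 0 < x \<bullet> (A *v x))"

definition nonneg_def :: "real ^ 'd ^ 'd \<Rightarrow> bool" where
  "nonneg_def A \<longleftrightarrow> transpose A = A \<and> (\<forall>x. 0 \<le> x \<bullet> (A *v x))"

text \<open>
  \<open>k\<close> times continuously differentiable on \<open>S\<close>, which in this development is a closed ball or a
  closed interval. Derivatives are taken within \<open>S\<close>, i.e. they are one-sided at boundary points.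
\<close>
primrec cont_diff :: "nat \<Rightarrow> 'a::euclidean_space set \<Rightarrow> ('a \<Rightarrow> real) \<Rightarrow> bool" where
  "cont_diff 0 S f \<longleftrightarrow> continuous_on S f"
| "cont_diff (Suc k) S f \<longleftrightarrow>
     (\<exists>f'. (\<forall>x\<in>S. (f has_derivative f' x) (at x within S)) \<and>
           (\<forall>v\<in>Basis. cont_diff k S (\<lambda>x. f' x v)))"

text \<open>
  The set \<open>C\<^sup>\<infinity>(S)\<close>. A function on \<open>S\<close> is represented by the total function that is \<open>0\<close> off \<open>S\<close>,
  so that arbitrary values off \<open>S\<close> cannot spoil measurability.
\<close>
definition C_inf :: "'a::euclidean_space set \<Rightarrow> ('a \<Rightarrow> real) set" where
  "C_inf S = {\<phi>. (\<forall>k. cont_diff k S \<phi>) \<and> (\<forall>x. x \<notin> S \<longrightarrow> \<phi> x = 0)}"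

section \<open>Weak convergence of processes to a Gaussian process\<close>

text \<open>The space of bounded functions on \<open>S\<close> with the supremum distance.\<close>
definition ell_inf :: "real set \<Rightarrow> (real \<Rightarrow> real) metric" where
  "ell_inf S = funspace S euclidean_metric"

text \<open>
  Outer expectation of a possibly non-measurable (here: bounded) function, as in the theory of
  Hoffmann-Joergensen.
\<close>
definition outer_expectation :: "'a measure \<Rightarrow> ('a \<Rightarrow> real) \<Rightarrow> real" where
  "outer_expectation M f =
     Inf {integral\<^sup>L M g | g. integrable M g \<and> (AE \<omega> in M. f \<omega> \<le> g \<omega>)}"

text \<open>Normal laws on the line, including the degenerate ones.\<close>
definition gaussian_law :: "real measure \<Rightarrow> bool" where
  "gaussian_law D \<longleftrightarrow>
     (\<exists>a. D = return borel a) \<or> (\<exists>a s. 0 < s \<and> D = density lborel (normal_density a s))"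

text \<open>
  A Borel probability law on \<open>ell_inf S\<close> all of whose finite-dimensional distributions are
  multivariate normal, i.e. have normal linear combinations.
\<close>
definition gaussian_process_law :: "real set \<Rightarrow> (real \<Rightarrow> real) measure \<Rightarrow> bool" where
  "gaussian_process_law S N \<longleftrightarrow>
     prob_space N \<and> space N = mspace (ell_inf S) \<and>
     sets N = sigma_sets (mspace (ell_inf S)) {U. openin (mtopology_of (ell_inf S)) U} \<and>
     (\<forall>F a. finite F \<longrightarrow> F \<subseteq> S \<longrightarrow> gaussian_law (distr N borel (\<lambda>x. \<Sum>t\<in>F. a t * x t)))"

definition converges_to_law ::
    "'a measure \<Rightarrow> real set \<Rightarrow> (nat \<Rightarrow> 'a \<Rightarrow> real \<Rightarrow> real) \<Rightarrow> (real \<Rightarrow> real) measure \<Rightarrow> bool" where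
  "converges_to_law M S X N \<longleftrightarrow>
     (\<forall>H. continuous_map (mtopology_of (ell_inf S)) euclideanreal H \<longrightarrow>
          bounded (H ` mspace (ell_inf S)) \<longrightarrow>
          (\<lambda>n. outer_expectation M (\<lambda>\<omega>. H (X n \<omega>))) \<longlonglongrightarrow> integral\<^sup>L N H)"

definition converges_to_gaussian_process ::
    "'a measure \<Rightarrow> real set \<Rightarrow> (nat \<Rightarrow> 'a \<Rightarrow> real \<Rightarrow> real) \<Rightarrow> bool" where
  "converges_to_gaussian_process M S X \<longleftrightarrow>
     (\<exists>N. gaussian_process_law S N \<and> converges_to_law M S X N)"

section \<open>The Cox model\<close>

definition cond_expect ::
    "'a measure \<Rightarrow> ('a \<Rightarrow> 'b::{banach, second_countable_topology}) \<Rightarrow> 'a set \<Rightarrow> 'b" where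
  "cond_expect M X A = (LINT \<omega>:A|M. X \<omega>) /\<^sub>R measure M A"

text \<open>Time is \<open>[0, \<infinity>)\<close>; values of a process at negative times are irrelevant.\<close>
definition path :: "(real \<Rightarrow> 'a \<Rightarrow> 'b) \<Rightarrow> 'a \<Rightarrow> real \<Rightarrow> 'b" where
  "path Z \<omega> = (\<lambda>t\<in>{0..}. Z t \<omega>)"

definition left_cont_right_lim :: "(real \<Rightarrow> 'b::topological_space) \<Rightarrow> bool" where
  "left_cont_right_lim z \<longleftrightarrow>
     (\<forall>t>0. continuous (at_left t) z) \<and> (\<forall>t\<ge>0. \<exists>l. (z \<longlongrightarrow> l) (at_right t))"

definition covariate_process :: "'a measure \<Rightarrow> (real \<Rightarrow> 'a \<Rightarrow> real ^ 'd) \<Rightarrow> bool" where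
  "covariate_process M Z \<longleftrightarrow>
     (\<forall>t\<ge>0. Z t \<in> borel_measurable M) \<and>
     (\<forall>\<omega>\<in>space M. left_cont_right_lim (\<lambda>t. Z t \<omega>))"

definition sigma_process :: "'a measure \<Rightarrow> (real \<Rightarrow> 'a \<Rightarrow> real ^ 'd) \<Rightarrow> 'a measure" where
  "sigma_process M Z = vimage_algebra (space M) (path Z) (Pi\<^sub>M {0..} (\<lambda>_. borel))"

definition cond_indep_given :: "'a measure \<Rightarrow> 'a measure \<Rightarrow> ('a \<Rightarrow> real) \<Rightarrow> ('a \<Rightarrow> real) \<Rightarrow> bool" where
  "cond_indep_given M F T C \<longleftrightarrow>
     (\<forall>A\<in>sets borel. \<forall>B\<in>sets borel. AE \<omega> in M.
        real_cond_exp M F (indicator {\<omega>\<in>space M. T \<omega> \<in> A \<and> C \<omega> \<in> B}) \<omega> =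
        real_cond_exp M F (indicator {\<omega>\<in>space M. T \<omega> \<in> A}) \<omega> *
        real_cond_exp M F (indicator {\<omega>\<in>space M. C \<omega> \<in> B}) \<omega>)"

definition exp_minus :: "ennreal \<Rightarrow> real" where
  "exp_minus u = (if u = \<infinity> then 0 else exp (- enn2real u))"

text \<open>
  \<open>h\<close> is the hazard of \<open>T\<close> given \<open>F\<close>: the conditional survival function at \<open>t\<close> is
  \<open>exp (- \<integral>\<^sub>0\<^sup>t h)\<close>, where the cumulative hazard may become infinite.
\<close>
definition has_cond_hazard ::
    "'a measure \<Rightarrow> 'a measure \<Rightarrow> ('a \<Rightarrow> real) \<Rightarrow> (real \<Rightarrow> 'a \<Rightarrow> real) \<Rightarrow> bool" where
  "has_cond_hazard M F T h \<longleftrightarrow>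
     (\<forall>t\<ge>0. AE \<omega> in M.
        real_cond_exp M F (indicator {\<omega>\<in>space M. T \<omega> > t}) \<omega> =
        exp_minus (\<integral>\<^sup>+s\<in>{0..t}. ennreal (h s \<omega>) \<partial>lborel))"

definition cox_model ::
    "'a measure \<Rightarrow> ('a \<Rightarrow> real) \<Rightarrow> ('a \<Rightarrow> real) \<Rightarrow> (real \<Rightarrow> 'a \<Rightarrow> real ^ 'd) \<Rightarrow>
     real ^ 'd \<Rightarrow> (real \<Rightarrow> real) \<Rightarrow> bool" where
  "cox_model M T C Z \<beta> h0 \<longleftrightarrow>
     T \<in> borel_measurable M \<and> (AE \<omega> in M. 0 \<le> T \<omega>) \<and>
     C \<in> borel_measurable M \<and> (AE \<omega> in M. 0 \<le> C \<omega>) \<and>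
     covariate_process M Z \<and>
     set_borel_measurable borel {0..} h0 \<and> (\<forall>t\<ge>0. 0 \<le> h0 t) \<and>
     cond_indep_given M (sigma_process M Z) T C \<and>
     has_cond_hazard M (sigma_process M Z) T (\<lambda>t \<omega>. h0 t * exp (\<beta> \<bullet> Z t \<omega>))"

definition observation ::
    "('a \<Rightarrow> real) \<Rightarrow> ('a \<Rightarrow> real) \<Rightarrow> (real \<Rightarrow> 'a \<Rightarrow> real ^ 'd) \<Rightarrow> 'a \<Rightarrow> real \<times> real \<times> (real \<Rightarrow> real ^ 'd)"
  where "observation T C Z \<omega> = (T \<omega>, C \<omega>, path Z \<omega>)"

definition observation_space :: "(real \<times> real \<times> (real \<Rightarrow> real ^ 'd)) measure" where
  "observation_space = borel \<Otimes>\<^sub>M borel \<Otimes>\<^sub>M Pi\<^sub>M {0..} (\<lambda>_. borel)"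

text \<open>
  Path regularity is required of each copy separately: it is not determined by the law on the
  product \<open>\<sigma>\<close>-algebra.
\<close>
definition iid_copies ::
    "'a measure \<Rightarrow> ('a \<Rightarrow> real) \<Rightarrow> ('a \<Rightarrow> real) \<Rightarrow> (real \<Rightarrow> 'a \<Rightarrow> real ^ 'd) \<Rightarrow>
     (nat \<Rightarrow> 'a \<Rightarrow> real) \<Rightarrow> (nat \<Rightarrow> 'a \<Rightarrow> real) \<Rightarrow> (nat \<Rightarrow> real \<Rightarrow> 'a \<Rightarrow> real ^ 'd) \<Rightarrow> bool" where
  "iid_copies M T C Z Ts Cs Zs \<longleftrightarrow>
     prob_space.indep_vars M (\<lambda>_. observation_space) (\<lambda>i. observation (Ts i) (Cs i) (Zs i)) {1..} \<and>
     (\<forall>i\<ge>1. covariate_process M (Zs i) \<and>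
        distr M observation_space (observation (Ts i) (Cs i) (Zs i)) =
        distr M observation_space (observation T C Z))"

definition follow_up :: "('a \<Rightarrow> real) \<Rightarrow> ('a \<Rightarrow> real) \<Rightarrow> 'a \<Rightarrow> real" where
  "follow_up T C \<omega> = min (T \<omega>) (C \<omega>)"

definition at_risk :: "('a \<Rightarrow> real) \<Rightarrow> real \<Rightarrow> 'a \<Rightarrow> real" where
  "at_risk Y t \<omega> = (if t \<le> Y \<omega> then 1 else 0)"

text \<open>
  The end of follow-up is an extended real, so that it is meaningful without assuming finiteness.
  If all times in \<open>[0, end_time]\<close>, including the end point, have a positive chance of being at risk,
  then it is finite.
\<close>
definition end_time :: "'a measure \<Rightarrow> ('a \<Rightarrow> real) \<Rightarrow> ereal" where
  "end_time M Y = Sup (ereal ` {t. 0 < measure M {\<omega>\<in>space M. t < Y \<omega>}})"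

definition time_window :: "'a measure \<Rightarrow> ('a \<Rightarrow> real) \<Rightarrow> real set" where
  "time_window M Y = {t. 0 \<le> t \<and> ereal t \<le> end_time M Y}"

section \<open>The matrices\<close>

definition mu_fun :: "'a measure \<Rightarrow> ('a \<Rightarrow> real) \<Rightarrow> (real \<Rightarrow> 'a \<Rightarrow> real ^ 'd) \<Rightarrow> real ^ 'd \<Rightarrow> real \<Rightarrow> real ^ 'd"
  where
  "mu_fun M Y Z \<beta> t =
     (LINT \<omega>|M. (exp (\<beta> \<bullet> Z t \<omega>) * at_risk Y t \<omega>) *\<^sub>R Z t \<omega>) /\<^sub>R
     (LINT \<omega>|M. exp (\<beta> \<bullet> Z t \<omega>) * at_risk Y t \<omega>)"

definition Sigma_C ::
    "'a measure \<Rightarrow> ('a \<Rightarrow> real) \<Rightarrow> (real \<Rightarrow> 'a \<Rightarrow> real ^ 'd) \<Rightarrow> real ^ 'd \<Rightarrow> (real \<Rightarrow> real) \<Rightarrow> real ^ 'd ^ 'd"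
  where
  "Sigma_C M Y Z \<beta> h0 =
     (LINT t:time_window M Y|lborel. h0 t *\<^sub>R
        (LINT \<omega>|M. (exp (\<beta> \<bullet> Z t \<omega>) * at_risk Y t \<omega>) *\<^sub>R outer2 (Z t \<omega> - mu_fun M Y Z \<beta> t)))"

definition Sigma_a ::
    "'a measure \<Rightarrow> ('a \<Rightarrow> real) \<Rightarrow> (real \<Rightarrow> 'a \<Rightarrow> real ^ 'd) \<Rightarrow>
     (nat \<Rightarrow> 'a \<Rightarrow> real) \<Rightarrow> (nat \<Rightarrow> real \<Rightarrow> 'a \<Rightarrow> real ^ 'd) \<Rightarrow>
     real ^ 'd \<Rightarrow> (real \<Rightarrow> real) \<Rightarrow> nat \<Rightarrow> real ^ 'd ^ 'd"
  where
  "Sigma_a M Y Z Ys Zs \<beta> h0 m =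
     (1 / (real m + 1)) *\<^sub>R
     (LINT t:time_window M Y|lborel.
        (measure M {\<omega>\<in>space M. t \<le> Y \<omega>} * h0 t) *\<^sub>R
        cond_expect M
          (\<lambda>\<omega>. outer2 (\<Sum>j=1..m+1. exp (\<beta> \<bullet> Zs j t \<omega>) *\<^sub>R (Zs j t \<omega> - mu_fun M Y Z \<beta> t)) /\<^sub>R
                (\<Sum>j=1..m+1. exp (\<beta> \<bullet> Zs j t \<omega>)))
          {\<omega>\<in>space M. \<forall>j\<in>{1..m+1}. t \<le> Ys j \<omega>})"

definition Sigma_P ::
    "'a measure \<Rightarrow> ('a \<Rightarrow> real) \<Rightarrow> (real \<Rightarrow> 'a \<Rightarrow> real ^ 'd) \<Rightarrow>
     (nat \<Rightarrow> 'a \<Rightarrow> real) \<Rightarrow> (nat \<Rightarrow> real \<Rightarrow> 'a \<Rightarrow> real ^ 'd) \<Rightarrow>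
     real ^ 'd \<Rightarrow> (real \<Rightarrow> real) \<Rightarrow> nat \<Rightarrow> real ^ 'd ^ 'd"
  where
  "Sigma_P M Y Z Ys Zs \<beta> h0 m = Sigma_C M Y Z \<beta> h0 - Sigma_a M Y Z Ys Zs \<beta> h0 m"

definition b_fun :: "'a measure \<Rightarrow> ('a \<Rightarrow> real) \<Rightarrow> (real \<Rightarrow> 'a \<Rightarrow> real ^ 'd) \<Rightarrow> real ^ 'd \<Rightarrow> real \<Rightarrow> real"
  where
  "b_fun M Y Z \<beta> t = cond_expect M (\<lambda>\<omega>. exp (\<beta> \<bullet> Z t \<omega>)) {\<omega>\<in>space M. t \<le> Y \<omega>}"

definition w_fun ::
    "'a measure \<Rightarrow> ('a \<Rightarrow> real) \<Rightarrow> (real \<Rightarrow> 'a \<Rightarrow> real ^ 'd) \<Rightarrow> real ^ 'd \<Rightarrow> nat \<Rightarrow> real \<Rightarrow> 'a \<Rightarrow> real"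
  where
  "w_fun M Y Z \<beta> m t \<omega> =
     real m * b_fun M Y Z \<beta> t / (exp (\<beta> \<bullet> Z t \<omega>) + real m * b_fun M Y Z \<beta> t)"

definition g_fun ::
    "'a measure \<Rightarrow> ('a \<Rightarrow> real) \<Rightarrow> (real \<Rightarrow> 'a \<Rightarrow> real ^ 'd) \<Rightarrow> real ^ 'd \<Rightarrow> nat \<Rightarrow> real \<Rightarrow> real ^ 'd"
  where
  "g_fun M Y Z \<beta> m t =
     (LINT \<omega>|M. (w_fun M Y Z \<beta> m t \<omega> * exp (\<beta> \<bullet> Z t \<omega>) * at_risk Y t \<omega>) *\<^sub>R Z t \<omega>) /\<^sub>R
     (LINT \<omega>|M. w_fun M Y Z \<beta> m t \<omega> * exp (\<beta> \<bullet> Z t \<omega>) * at_risk Y t \<omega>)"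

definition Sigma_w ::
    "'a measure \<Rightarrow> ('a \<Rightarrow> real) \<Rightarrow> (real \<Rightarrow> 'a \<Rightarrow> real ^ 'd) \<Rightarrow> real ^ 'd \<Rightarrow> (real \<Rightarrow> real) \<Rightarrow> nat \<Rightarrow>
     real ^ 'd ^ 'd"
  where
  "Sigma_w M Y Z \<beta> h0 m =
     (LINT t:time_window M Y|lborel. h0 t *\<^sub>R
        (LINT \<omega>|M. (w_fun M Y Z \<beta> m t \<omega> * exp (\<beta> \<bullet> Z t \<omega>) * at_risk Y t \<omega>) *\<^sub>R
                    outer2 (Z t \<omega> - g_fun M Y Z \<beta> m t)))"

end

(*
  Fix a time t and a vector x, let Q be the law of Z(t) given Y >= t, and write theta = exp(beta'Z),
  u = x'Z, b = E theta, f = u - x'g, phi = f theta / (theta + m b) and eta = theta - b. Then phi and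
  eta have mean zero. For an i.i.d. sample of size m + 1 from Q put S = sum theta_j and
  D = sum theta_j f_j - (sum phi_j) S = - sum_{j /= k} phi_j eta_k. The quadratic form of the
  integrand of Sigma_P is the mean of the weighted variance of u within such a sample, and
  orthogonality, E[(sum phi_j) D] = 0, shows that it falls short of that of Sigma by exactly
  E[D^2 / S] / (m + 1), up to the factor pr(Y >= t) lambda_0(t). Hence Sigma_P <= Sigma, and
  inversion reverses the order.
  If the inverses agree, then D = 0 for almost every t. Testing D against phi_1 eta_2 gives
  E phi^2 E eta^2 + (E phi eta)^2 = 0; for x = beta, where u = ln theta, either alternative makes u
  degenerate, so beta' Sigma beta = 0 and beta = 0. Conversely beta = 0 gives eta = 0 and D = 0.
*)
theory Submission
  imports Defs
begin

section \<open>Weighted variance within a sample\<close>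

text \<open>Origin of \<open>\<phi>\<close>: given that one member of the sample has covariate
  \<open>z\<close>, the mean of \<open>S\<close> is \<open>\<theta> z + m * b\<close>, since each of
  the other \<open>m\<close> members contributes \<open>b\<close>. Thus \<open>\<phi>\<close> is
  \<open>\<theta> * f\<close> divided by this conditional mean instead of by \<open>S\<close>, and
  \<open>D\<close> collects the errors of that replacement: \<open>D / S\<close> is the
  \<open>\<theta>\<close>-weighted sample mean of \<open>f\<close> minus the additive statistic
  formed from \<open>\<phi>\<close>. The weight \<open>m * b / (\<theta> + m * b)\<close> in
  \<open>Sigma_w\<close> makes \<open>w * \<theta> * f\<close> equal to
  \<open>m * b * \<phi>\<close>, so the definition of \<open>g\<close> says exactly that
  \<open>\<phi>\<close> has mean zero. The obstacle is the random denominator \<open>S\<close>: an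
  expectation involving \<open>1 / S\<close> does not factor over the coordinates. Apart from the
  term that \<open>Sigma_a\<close> itself contains, the algebra confines this denominator to
  \<open>D^2 / S\<close>, of which only the sign and the vanishing matter. All moments that are
  evaluated are those of polynomials in functions of single coordinates, and these do factor. Over
  time the obstacle is measurability in \<open>t\<close>, which has to be drawn from the left
  continuity of the paths.\<close>

lemma AE_PiM_finite:
  assumes "finite J" "prob_space Q" "AE z in Q. P z"
  shows "AE x in Pi\<^sub>M J (\<lambda>_. Q). \<forall>j\<in>J. P (x j)"
proof (rule AE_finite_allI[OF assms(1)])
  fix j assume "j \<in> J"
  then show "AE x in Pi\<^sub>M J (\<lambda>_. Q). P (x j)"
    by (rule AE_PiM_component[OF assms(2) _ assms(3)])
qed

text \<open>
  \<open>Q\<close> is the law of the covariate among those at risk, \<open>u\<close> a linear functional of it, and \<open>J\<close>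
  indexes the case together with its \<open>m\<close> controls. The last assumption says that \<open>g\<close> is the
  \<open>\<theta>w\<close>-weighted mean of \<open>u\<close>, after division by \<open>m E \<theta>\<close>.
\<close>
locale case_control_sample = prob_space Q for Q :: "'b measure" +
  fixes J :: "'i set" and \<theta> u :: "'b \<Rightarrow> real" and l h K g :: real and m :: nat
  assumes finite_J: "finite J" and card_J: "card J = m + 1"
    and meas_\<theta>[measurable]: "\<theta> \<in> borel_measurable Q" and meas_u[measurable]: "u \<in> borel_measurable Q"
    and l_pos: "0 < l" and bound_\<theta>: "AE z in Q. l \<le> \<theta> z \<and> \<theta> z \<le> h" and bound_u: "AE z in Q. \<bar>u z\<bar> \<le> K"
    and m_pos: "0 < m"
    and balance: "expectation (\<lambda>z. \<theta> z * (u z - g) / (\<theta> z + real m * expectation \<theta>)) = 0"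
begin

definition "b = expectation \<theta>"
definition "f z = u z - g"
definition "\<phi> z = \<theta> z * f z / (\<theta> z + real m * b)"
definition "\<eta> z = \<theta> z - b"
definition "N = Pi\<^sub>M J (\<lambda>_. Q)"
definition "S x = (\<Sum>j\<in>J. \<theta> (x j))"
definition "D x = (\<Sum>j\<in>J. \<theta> (x j) * f (x j)) - (\<Sum>j\<in>J. \<phi> (x j)) * S x"

lemma measurable_parts[measurable]:
  "f \<in> borel_measurable Q" "\<phi> \<in> borel_measurable Q" "\<eta> \<in> borel_measurable Q"
  unfolding f_def[abs_def] \<phi>_def[abs_def] \<eta>_def[abs_def] by measurable

lemma measurable_samples[measurable]: "S \<in> borel_measurable N" "D \<in> borel_measurable N"
  unfolding S_def[abs_def] D_def[abs_def] N_def by measurable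

sublocale N: prob_space N
  unfolding N_def by (intro prob_space_PiM) unfold_locales

section \<open>Essentially bounded functions of one covariate\<close>

lemma integrable_AE_bounded:
  assumes "F \<in> borel_measurable Q" "AE z in Q. \<bar>F z\<bar> \<le> B"
  shows "integrable Q (F :: 'b \<Rightarrow> real)"
  using assms by (intro integrable_const_bound[of _ B]) auto

lemma b_ge: "l \<le> b"
proof -
  have i: "integrable Q \<theta>"
    by (rule integrable_AE_bounded[of _ h]) (use bound_\<theta> l_pos in auto)
  show ?thesis unfolding b_def
    using integral_mono_AE[OF _ i, of "\<lambda>_. l"] bound_\<theta> by (simp add: prob_space)
qed

text \<open>The bound is hidden behind an existential on purpose: the class is closed under products
  and differences, so polynomials in \<open>\<theta>\<close>, \<open>u\<close>,
  \<open>\<phi>\<close> and \<open>\<eta>\<close> are integrable without any tracking of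
  constants.\<close>

definition "bounded_var F \<longleftrightarrow> F \<in> borel_measurable Q \<and> (\<exists>B. AE z in Q. \<bar>F z\<bar> \<le> (B::real))"

lemma bounded_varI: "F \<in> borel_measurable Q \<Longrightarrow> AE z in Q. \<bar>F z\<bar> \<le> (B::real) \<Longrightarrow> bounded_var F"
  unfolding bounded_var_def by auto

lemma bounded_var_integrable: "bounded_var F \<Longrightarrow> integrable Q F"
  unfolding bounded_var_def using integrable_AE_bounded by blast

lemma bounded_var_mult[intro]:
  assumes "bounded_var F" "bounded_var G"
  shows "bounded_var (\<lambda>z. F z * G z)"
proof -
  obtain B C where "AE z in Q. \<bar>F z\<bar> \<le> B" "AE z in Q. \<bar>G z\<bar> \<le> C"
    using assms unfolding bounded_var_def by blast
  then have "AE z in Q. \<bar>F z * G z\<bar> \<le> B * C"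
  proof eventually_elim
    case (elim z)
    then show ?case unfolding abs_mult by (intro mult_mono) linarith+
  qed
  then show ?thesis using assms unfolding bounded_var_def by (intro conjI exI) auto
qed

lemma bounded_var_diff[intro]:
  assumes "bounded_var F" "bounded_var G"
  shows "bounded_var (\<lambda>z. F z - G z)"
proof -
  obtain B C where "AE z in Q. \<bar>F z\<bar> \<le> B" "AE z in Q. \<bar>G z\<bar> \<le> C"
    using assms unfolding bounded_var_def by blast
  then have "AE z in Q. \<bar>F z - G z\<bar> \<le> B + C"
    by eventually_elim auto
  then show ?thesis using assms unfolding bounded_var_def by (intro conjI exI) auto
qed

lemma bounded_var_const[intro, simp]: "bounded_var (\<lambda>_. k)"
  by (rule bounded_varI[of _ "\<bar>k\<bar>"]) auto

lemma bounded_var_if[intro]: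
  "bounded_var F \<Longrightarrow> bounded_var G \<Longrightarrow> bounded_var (\<lambda>z. if P then F z else G z)"
  by (cases P) auto

lemma bounded_var_parts[intro, simp]: "bounded_var \<theta>" "bounded_var u" "bounded_var f" "bounded_var \<phi>" "bounded_var \<eta>"
proof -
  show t: "bounded_var \<theta>" by (rule bounded_varI[of _ h]) (use bound_\<theta> l_pos in auto)
  show u: "bounded_var u" by (rule bounded_varI[OF _ bound_u]) auto
  show f: "bounded_var f" unfolding f_def[abs_def] using u by auto
  show "bounded_var \<eta>" unfolding \<eta>_def[abs_def] using t by auto
  obtain B where "AE z in Q. \<bar>f z\<bar> \<le> B" using f unfolding bounded_var_def by blast
  with bound_\<theta> have "AE z in Q. \<bar>\<phi> z\<bar> \<le> B"
  proof eventually_elim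
    case (elim z)
    \<comment> \<open>The factor \<open>\<theta> / (\<theta> + m * b)\<close> lies between 0 and 1,
      so \<open>\<phi>\<close> inherits the bound of \<open>f\<close>.\<close>
    have "\<bar>\<phi> z\<bar> = \<bar>f z\<bar> * (\<theta> z / (\<theta> z + m * b))"
      using elim l_pos b_ge by (simp add: \<phi>_def abs_mult)
    also have "\<dots> \<le> \<bar>f z\<bar> * 1"
      using elim l_pos b_ge by (intro mult_left_mono) (auto simp: divide_le_eq_1)
    finally show ?case using elim by simp
  qed
  then show "bounded_var \<phi>" by (rule bounded_varI[rotated]) simp
qed

lemma expectation_\<phi>: "expectation \<phi> = 0" and expectation_\<eta>: "expectation \<eta> = 0"
proof -
  show "expectation \<phi> = 0" using balance by (simp add: \<phi>_def[abs_def] f_def b_def)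
  show "expectation \<eta> = 0" unfolding \<eta>_def[abs_def]
    by (subst Bochner_Integration.integral_diff) (auto simp: bounded_var_integrable prob_space b_def)
qed

section \<open>Mixed moments over the i.i.d. sample\<close>

sublocale prod: product_sigma_finite "\<lambda>_. Q" ..

lemma
  assumes "\<And>i. i \<in> J \<Longrightarrow> bounded_var (F i)"
  shows N_integrable_prod: "integrable N (\<lambda>x. \<Prod>i\<in>J. F i (x i))"
    and N_expectation_prod: "N.expectation (\<lambda>x. \<Prod>i\<in>J. F i (x i)) = (\<Prod>i\<in>J. expectation (F i))"
  unfolding N_def
  by (rule prod.product_integrable_prod prod.product_integral_prod, rule finite_J,
      rule bounded_var_integrable, erule assms)+

text \<open>The indices may coincide: \<open>P r\<close> gathers all factors attached to coordinate
  \<open>r\<close>, so independence applies without a case split. Four slots are what testing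
  \<open>D\<close> against a product of two functions requires; spare slots hold the constant
  1.\<close>

lemma
  assumes "bounded_var F" "bounded_var G" "bounded_var H" "bounded_var L" "{i,j,k,n} \<subseteq> J"
  defines "P \<equiv> \<lambda>r z. (if r = i then F z else 1) * (if r = j then G z else 1) *
    (if r = k then H z else 1) * (if r = n then L z else 1)"
  shows N_integrable4: "integrable N (\<lambda>x. F (x i) * G (x j) * H (x k) * L (x n))"
    and N_expectation4: "N.expectation (\<lambda>x. F (x i) * G (x j) * H (x k) * L (x n)) = (\<Prod>r\<in>J. expectation (P r))"
proof -
  have e: "(\<lambda>x. F (x i) * G (x j) * H (x k) * L (x n)) = (\<lambda>x. \<Prod>r\<in>J. P r (x r))"
    using assms(5) finite_J by (auto simp: P_def prod.distrib prod.delta fun_eq_iff)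
  have b: "bounded_var (P r)" for r
    unfolding P_def using assms by (intro bounded_var_mult bounded_var_if) auto
  show "integrable N (\<lambda>x. F (x i) * G (x j) * H (x k) * L (x n))"
    unfolding e by (rule N_integrable_prod) (rule b)
  show "N.expectation (\<lambda>x. F (x i) * G (x j) * H (x k) * L (x n)) = (\<Prod>r\<in>J. expectation (P r))"
    unfolding e by (rule N_expectation_prod) (rule b)
qed

text \<open>A single coordinate \<open>r\<close> whose gathered factor has mean zero kills the whole
  moment.\<close>

lemma N_expectation4_eq_0:
  assumes "bounded_var F" "bounded_var G" "bounded_var H" "bounded_var L" "{i,j,k,n} \<subseteq> J"
    and "r \<in> J" "expectation (\<lambda>z. (if r = i then F z else 1) * (if r = j then G z else 1) *
    (if r = k then H z else 1) * (if r = n then L z else 1)) = 0"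
  shows "N.expectation (\<lambda>x. F (x i) * G (x j) * H (x k) * L (x n)) = 0"
  unfolding N_expectation4[OF assms(1-5)] by (rule prod_zero[OF finite_J], rule bexI[where x=r]) (fact assms)+

lemma N_expectation1:
  assumes "bounded_var F" "i \<in> J"
  shows "integrable N (\<lambda>x. F (x i))" "N.expectation (\<lambda>x. F (x i)) = expectation F"
proof -
  show "integrable N (\<lambda>x. F (x i))"
    using N_integrable4[of F "\<lambda>_. 1" "\<lambda>_. 1" "\<lambda>_. 1" i i i i] assms by simp
  have "N.expectation (\<lambda>x. F (x i)) = (\<Prod>r\<in>J. expectation (\<lambda>z. if r = i then F z else 1))"
    using N_expectation4[of F "\<lambda>_. 1" "\<lambda>_. 1" "\<lambda>_. 1" i i i i] assms by simp
  also have "\<dots> = (\<Prod>r\<in>J. if r = i then expectation F else 1)"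
    by (intro prod.cong) (auto simp: prob_space)
  finally show "N.expectation (\<lambda>x. F (x i)) = expectation F" using assms finite_J by simp
qed

text \<open>
  Each summand pairs a mean-zero function of one coordinate with a mean-zero function of another.
\<close>
lemma D_eq:
  assumes "\<And>j. j \<in> J \<Longrightarrow> 0 < \<theta> (x j)"
  shows "D x = - (\<Sum>j\<in>J. \<Sum>k\<in>J - {j}. \<phi> (x j) * \<eta> (x k))"
proof -
  have "\<theta> (x j) * f (x j) - \<phi> (x j) * S x = - (\<Sum>k\<in>J - {j}. \<phi> (x j) * \<eta> (x k))" if "j \<in> J" for j
  proof -
    have "S x = \<theta> (x j) + (\<Sum>k\<in>J - {j}. \<theta> (x k))"
      unfolding S_def using that finite_J by (simp add: sum.remove)
    moreover have "\<theta> (x j) * f (x j) = \<phi> (x j) * (\<theta> (x j) + m * b)"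
      using assms[OF that] b_ge l_pos by (simp add: \<phi>_def add_pos_nonneg less_imp_neq[THEN not_sym])
    \<comment> \<open>\<open>J - {j}\<close> has \<open>m\<close> elements, so centring removes
      exactly the \<open>m * b\<close> that stands in the denominator of
      \<open>\<phi>\<close>.\<close>
    moreover have "(\<Sum>k\<in>J - {j}. \<eta> (x k)) = (\<Sum>k\<in>J - {j}. \<theta> (x k)) - m * b"
      using that finite_J card_J by (simp add: \<eta>_def sum_subtractf)
    ultimately show ?thesis
      unfolding sum_distrib_left[symmetric] by (simp add: right_diff_distrib distrib_left)
  qed
  then show ?thesis unfolding D_def
    by (simp add: sum_distrib_right sum_subtractf[symmetric] sum_negf[symmetric])
qed

lemma AE_N: "AE z in Q. P z \<Longrightarrow> AE x in N. \<forall>j\<in>J. P (x j)"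
  unfolding N_def by (rule AE_PiM_finite[OF finite_J prob_space_axioms])

lemma AE_S: "AE x in N. (\<forall>j\<in>J. 0 < \<theta> (x j)) \<and> 0 < S x \<and> l \<le> S x \<and> S x \<le> (m + 1) * h"
  using AE_N[OF bound_\<theta>]
proof eventually_elim
  case (elim x)
  have "(\<Sum>j\<in>J. l) \<le> S x" "S x \<le> (\<Sum>j\<in>J. h)"
    unfolding S_def by (intro sum_mono; use elim in blast)+
  moreover have "l \<le> (m + 1) * l" using l_pos by simp
  ultimately have "l \<le> S x" "S x \<le> (m + 1) * h" using card_J by auto
  with elim l_pos show ?case by force
qed

lemma AE_D: "AE x in N. D x = - (\<Sum>j\<in>J. \<Sum>k\<in>J - {j}. \<phi> (x j) * \<eta> (x k))"
  using AE_S by eventually_elim (rule D_eq, auto)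

section \<open>Orthogonality and the information gap\<close>

lemma measurable_alpha[measurable]: "(\<lambda>x. \<Sum>i\<in>J. \<phi> (x i)) \<in> borel_measurable N"
  unfolding N_def by measurable

text \<open>In each term \<open>\<phi> (x i) * \<phi> (x j) * \<eta> (x k)\<close> with
  \<open>k\<close> distinct from \<open>j\<close>, some coordinate stands alone with a mean-zero
  factor: if \<open>k = i\<close> it is \<open>j\<close>, carrying \<open>\<phi>\<close>; otherwise
  it is \<open>k\<close>, carrying \<open>\<eta>\<close>.\<close>

lemma expectation_alpha_D:
  "integrable N (\<lambda>x. (\<Sum>i\<in>J. \<phi> (x i)) * D x)" "N.expectation (\<lambda>x. (\<Sum>i\<in>J. \<phi> (x i)) * D x) = 0"
proof -
  define T where "T i j k x = \<phi> (x i) * \<phi> (x j) * \<eta> (x k)" for i j k and x :: "'i \<Rightarrow> 'b"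
  let ?R = "\<lambda>x. - (\<Sum>i\<in>J. \<Sum>j\<in>J. \<Sum>k\<in>J - {j}. T i j k x)"
  have e: "AE x in N. (\<Sum>i\<in>J. \<phi> (x i)) * D x = ?R x"
    using AE_D
  proof eventually_elim
    case (elim x)
    have "(\<Sum>i\<in>J. \<phi> (x i)) * D x = - (\<Sum>i\<in>J. \<phi> (x i) * (\<Sum>j\<in>J. \<Sum>k\<in>J - {j}. \<phi> (x j) * \<eta> (x k)))"
      unfolding elim by (simp add: sum_distrib_right)
    then show ?case by (simp add: T_def sum_distrib_left mult.assoc)
  qed
  have iT: "integrable N (T i j k)" if "i \<in> J" "j \<in> J" "k \<in> J - {j}" for i j k
    using N_integrable4[of \<phi> \<phi> \<eta> "\<lambda>_. 1" i j k i] that by (simp add: T_def[abs_def])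
  have i: "integrable N ?R"
    by (intro Bochner_Integration.integrable_minus Bochner_Integration.integrable_sum iT)
  have z: "N.expectation (T i j k) = 0" if "i \<in> J" "j \<in> J" "k \<in> J - {j}" for i j k
  proof (cases "k = i")
    case True
    with that show ?thesis using expectation_\<phi>
      N_expectation4_eq_0[of \<phi> \<phi> \<eta> "\<lambda>_. 1" i j k i j] by (simp add: T_def[abs_def])
  next
    case False
    with that show ?thesis using expectation_\<eta>
      N_expectation4_eq_0[of \<phi> \<phi> \<eta> "\<lambda>_. 1" i j k i k] by (simp add: T_def[abs_def])
  qed
  have "N.expectation ?R = - (\<Sum>i\<in>J. \<Sum>j\<in>J. \<Sum>k\<in>J - {j}. N.expectation (T i j k))"
  proof -
    have "N.expectation ?R = - (\<Sum>i\<in>J. N.expectation (\<lambda>x. \<Sum>j\<in>J. \<Sum>k\<in>J - {j}. T i j k x))"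
      by (subst Bochner_Integration.integral_minus, subst Bochner_Integration.integral_sum)
        (intro Bochner_Integration.integrable_sum iT, assumption+, simp)
    also have "\<dots> = - (\<Sum>i\<in>J. \<Sum>j\<in>J. N.expectation (\<lambda>x. \<Sum>k\<in>J - {j}. T i j k x))"
      by (intro arg_cong[where f=uminus] sum.cong refl Bochner_Integration.integral_sum
          Bochner_Integration.integrable_sum iT)
    also have "\<dots> = - (\<Sum>i\<in>J. \<Sum>j\<in>J. \<Sum>k\<in>J - {j}. N.expectation (T i j k))"
      by (intro arg_cong[where f=uminus] sum.cong refl Bochner_Integration.integral_sum iT)
    finally show ?thesis .
  qed
  also have "\<dots> = 0" using z by simp
  finally have z': "N.expectation ?R = 0" .
  show "integrable N (\<lambda>x. (\<Sum>i\<in>J. \<phi> (x i)) * D x)"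
    by (rule integrable_cong_AE_imp[OF i _ AE_symmetric[OF e]]) measurable
  show "N.expectation (\<lambda>x. (\<Sum>i\<in>J. \<phi> (x i)) * D x) = 0"
    using integral_cong_AE[OF _ borel_measurable_integrable[OF i] e] z' by simp
qed


text \<open>Only the diagonal contributes: for distinct \<open>i\<close> and \<open>j\<close>,
  coordinate \<open>i\<close> carries nothing but \<open>\<phi>\<close>, which has mean
  zero.\<close>

lemma expectation_alpha_A:
  "integrable N (\<lambda>x. (\<Sum>i\<in>J. \<phi> (x i)) * (\<Sum>j\<in>J. \<theta> (x j) * f (x j)))"
  "N.expectation (\<lambda>x. (\<Sum>i\<in>J. \<phi> (x i)) * (\<Sum>j\<in>J. \<theta> (x j) * f (x j))) =
    (real m + 1) * expectation (\<lambda>z. \<phi> z * (\<theta> z * f z))"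
proof -
  define F where "F z = \<theta> z * f z" for z
  define T where "T i j x = \<phi> (x i) * F (x j)" for i j and x :: "'i \<Rightarrow> 'b"
  have bF: "bounded_var F" unfolding F_def[abs_def] by auto
  have e: "(\<lambda>x. (\<Sum>i\<in>J. \<phi> (x i)) * (\<Sum>j\<in>J. \<theta> (x j) * f (x j))) = (\<lambda>x. \<Sum>i\<in>J. \<Sum>j\<in>J. T i j x)"
    by (simp add: T_def F_def sum_product)
  have iT: "integrable N (T i j)" if "i \<in> J" "j \<in> J" for i j
    using N_integrable4[of \<phi> F "\<lambda>_. 1" "\<lambda>_. 1" i j i i] that bF by (simp add: T_def[abs_def])
  have ET: "N.expectation (T i j) = (if j = i then expectation (\<lambda>z. \<phi> z * F z) else 0)"
    if "i \<in> J" "j \<in> J" for i j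
  proof (cases "j = i")
    case True
    with that show ?thesis using N_expectation1(2)[of "\<lambda>z. \<phi> z * F z" i] bF
      by (simp add: T_def[abs_def] bounded_var_mult)
  next
    case False
    with that show ?thesis using expectation_\<phi> bF
      N_expectation4_eq_0[of \<phi> F "\<lambda>_. 1" "\<lambda>_. 1" i j i i i] by (simp add: T_def[abs_def])
  qed
  show "integrable N (\<lambda>x. (\<Sum>i\<in>J. \<phi> (x i)) * (\<Sum>j\<in>J. \<theta> (x j) * f (x j)))"
    unfolding e by (intro Bochner_Integration.integrable_sum iT)
  have "N.expectation (\<lambda>x. \<Sum>i\<in>J. \<Sum>j\<in>J. T i j x) = (\<Sum>i\<in>J. N.expectation (\<lambda>x. \<Sum>j\<in>J. T i j x))"
    by (intro Bochner_Integration.integral_sum Bochner_Integration.integrable_sum iT)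
  also have "\<dots> = (\<Sum>i\<in>J. \<Sum>j\<in>J. N.expectation (T i j))"
    by (intro sum.cong refl Bochner_Integration.integral_sum iT)
  also have "\<dots> = (\<Sum>i\<in>J. \<Sum>j\<in>J. if j = i then expectation (\<lambda>z. \<phi> z * F z) else 0)"
    by (intro sum.cong refl ET)
  also have "\<dots> = (real m + 1) * expectation (\<lambda>z. \<phi> z * F z)"
    using finite_J card_J by simp
  finally show "N.expectation (\<lambda>x. (\<Sum>i\<in>J. \<phi> (x i)) * (\<Sum>j\<in>J. \<theta> (x j) * f (x j))) =
    (real m + 1) * expectation (\<lambda>z. \<phi> z * (\<theta> z * f z))"
    unfolding e F_def .
qed

lemma expectation_sample_sum:
  assumes "bounded_var F"
  shows "integrable N (\<lambda>x. \<Sum>j\<in>J. F (x j))"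
    and "N.expectation (\<lambda>x. \<Sum>j\<in>J. F (x j)) = (real m + 1) * expectation F"
proof -
  show "integrable N (\<lambda>x. \<Sum>j\<in>J. F (x j))"
    by (intro Bochner_Integration.integrable_sum N_expectation1 assms)
  have "N.expectation (\<lambda>x. \<Sum>j\<in>J. F (x j)) = (\<Sum>j\<in>J. N.expectation (\<lambda>x. F (x j)))"
    by (intro Bochner_Integration.integral_sum N_expectation1 assms)
  also have "\<dots> = (\<Sum>j\<in>J. expectation F)"
    by (intro sum.cong refl N_expectation1 assms)
  finally show "N.expectation (\<lambda>x. \<Sum>j\<in>J. F (x j)) = (real m + 1) * expectation F"
    using card_J by (simp add: algebra_simps)
qed

lemma integrable_sample_mean_square:
  "integrable N (\<lambda>x. (\<Sum>j\<in>J. \<theta> (x j) * (u (x j) - \<mu>))\<^sup>2 / S x)"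
proof (rule N.integrable_const_bound)
  have "AE z in Q. \<bar>\<theta> z * (u z - \<mu>)\<bar> \<le> h * (K + \<bar>\<mu>\<bar>)"
    using bound_\<theta> bound_u
  proof eventually_elim
    case (elim z)
    then show ?case using l_pos unfolding abs_mult by (intro mult_mono) linarith+
  qed
  from AE_N[OF this] AE_S
  show "AE x in N. norm ((\<Sum>j\<in>J. \<theta> (x j) * (u (x j) - \<mu>))\<^sup>2 / S x) \<le> ((m + 1) * (h * (K + \<bar>\<mu>\<bar>)))\<^sup>2 / l"
  proof eventually_elim
    case (elim x)
    have "\<bar>\<Sum>j\<in>J. \<theta> (x j) * (u (x j) - \<mu>)\<bar> \<le> (\<Sum>j\<in>J. \<bar>\<theta> (x j) * (u (x j) - \<mu>)\<bar>)"
      by (rule sum_abs)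
    also have "\<dots> \<le> (\<Sum>j\<in>J. h * (K + \<bar>\<mu>\<bar>))"
      using elim by (intro sum_mono) blast
    also have "\<dots> = (m + 1) * (h * (K + \<bar>\<mu>\<bar>))" using card_J by simp
    finally have "(\<Sum>j\<in>J. \<theta> (x j) * (u (x j) - \<mu>))\<^sup>2 \<le> ((m + 1) * (h * (K + \<bar>\<mu>\<bar>)))\<^sup>2"
      by (rule abs_le_square_iff[THEN iffD1, OF order_trans[OF _ abs_ge_self]])
    then show ?case using elim l_pos by (auto intro!: frac_le)
  qed
  show "(\<lambda>x. (\<Sum>j\<in>J. \<theta> (x j) * (u (x j) - \<mu>))\<^sup>2 / S x) \<in> borel_measurable N"
    unfolding N_def S_def by measurable
qed

text \<open>The first factor is the weight of \<open>w_fun\<close>. Up to the probability of being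
  at risk, this is the quadratic form of \<open>weighted_information\<close> in the direction that
  defines \<open>u\<close>.\<close>

definition "W = expectation (\<lambda>z. real m * b / (\<theta> z + real m * b) * \<theta> z * (u z - g)\<^sup>2)"

text \<open>With \<open>A\<close> the sample sum of \<open>\<theta> * f\<close> and
  \<open>\<alpha>\<close> that of \<open>\<phi>\<close>, \<open>D = A - \<alpha> * S\<close> gives
  \<open>D^2 / S = A^2 / S - \<alpha> * A - \<alpha> * D\<close>. The last term has mean zero by
  orthogonality, and the mean of \<open>\<alpha> * A\<close> reduces to its diagonal.\<close>

lemma information_gap:
  shows "integrable N (\<lambda>x. (D x)\<^sup>2 / S x)"
    and "expectation (\<lambda>z. \<theta> z * (u z - \<mu>)\<^sup>2)
      - N.expectation (\<lambda>x. (\<Sum>j\<in>J. \<theta> (x j) * (u (x j) - \<mu>))\<^sup>2 / S x) / (real m + 1)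
      + N.expectation (\<lambda>x. (D x)\<^sup>2 / S x) / (real m + 1) = W"
proof -
  define V where "V x = (\<Sum>j\<in>J. \<theta> (x j) * (u (x j) - \<mu>)\<^sup>2)" for x
  define B where "B x = (\<Sum>j\<in>J. \<theta> (x j) * (u (x j) - \<mu>))\<^sup>2 / S x" for x
  define V' where "V' x = (\<Sum>j\<in>J. \<theta> (x j) * (f (x j))\<^sup>2)" for x
  define \<alpha> where "\<alpha> x = (\<Sum>j\<in>J. \<phi> (x j))" for x
  define A where "A x = (\<Sum>j\<in>J. \<theta> (x j) * f (x j))" for x
  have bu: "bounded_var (\<lambda>z. \<theta> z * (u z - \<mu>)\<^sup>2)" "bounded_var (\<lambda>z. \<theta> z * (f z)\<^sup>2)"
    unfolding power2_eq_square by (intro bounded_var_mult bounded_var_diff bounded_var_parts bounded_var_const)+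
  have V: "integrable N V" "N.expectation V = (real m + 1) * expectation (\<lambda>z. \<theta> z * (u z - \<mu>)\<^sup>2)"
    and V': "integrable N V'" "N.expectation V' = (real m + 1) * expectation (\<lambda>z. \<theta> z * (f z)\<^sup>2)"
    unfolding V_def[abs_def] V'_def[abs_def] by (intro expectation_sample_sum bu)+
  have B: "integrable N B" unfolding B_def[abs_def] by (rule integrable_sample_mean_square)
  have aA: "integrable N (\<lambda>x. \<alpha> x * A x)"
     "N.expectation (\<lambda>x. \<alpha> x * A x) = (real m + 1) * expectation (\<lambda>z. \<phi> z * (\<theta> z * f z))"
    unfolding \<alpha>_def A_def by (fact expectation_alpha_A)+
  have aD: "integrable N (\<lambda>x. \<alpha> x * D x)" "N.expectation (\<lambda>x. \<alpha> x * D x) = 0"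
    unfolding \<alpha>_def by (fact expectation_alpha_D)+
  \<comment> \<open>\<open>V' - V + B\<close> is \<open>A^2 / S\<close> in disguise:
    \<open>V - B\<close> is the same for the centre \<open>\<mu>\<close> as for \<open>g\<close>,
    and with the centre \<open>g\<close> it reads \<open>V' - A^2 / S\<close>.\<close>
  let ?R = "\<lambda>x. V' x - \<alpha> x * A x - \<alpha> x * D x - V x + B x"
  have e: "AE x in N. (D x)\<^sup>2 / S x = ?R x"
    using AE_S
  proof eventually_elim
    case (elim x)
    then have S: "S x \<noteq> 0" by auto
    \<comment> \<open>the within-sample weighted variance does not depend on the centring constant\<close>
    define d where "d = \<mu> - g"
    have A: "(\<Sum>j\<in>J. \<theta> (x j) * (u (x j) - \<mu>)) = A x - d * S x"
      unfolding A_def S_def f_def d_def sum_distrib_left sum_subtractf[symmetric]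
      by (intro sum.cong) (auto simp: algebra_simps)
    have V: "V x = V' x - 2 * d * A x + d\<^sup>2 * S x"
      unfolding V_def V'_def A_def S_def f_def d_def sum_distrib_left sum_subtractf[symmetric] sum.distrib[symmetric]
      by (intro sum.cong) (auto simp: algebra_simps power2_eq_square)
    have D: "D x = A x - \<alpha> x * S x" unfolding D_def A_def \<alpha>_def ..
    show ?case unfolding B_def A V D using S by (simp add: field_simps power2_eq_square)
  qed
  have R: "integrable N ?R" using V V' B aA aD by simp
  have mD: "(\<lambda>x. (D x)\<^sup>2 / S x) \<in> borel_measurable N" by measurable
  show "integrable N (\<lambda>x. (D x)\<^sup>2 / S x)" by (rule integrable_cong_AE_imp[OF R mD AE_symmetric[OF e]])
  have "N.expectation (\<lambda>x. (D x)\<^sup>2 / S x) = N.expectation ?R"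
    by (rule integral_cong_AE[OF mD borel_measurable_integrable[OF R] e])
  also have "\<dots> = (real m + 1) * (expectation (\<lambda>z. \<theta> z * (f z)\<^sup>2) - expectation (\<lambda>z. \<phi> z * (\<theta> z * f z))
      - expectation (\<lambda>z. \<theta> z * (u z - \<mu>)\<^sup>2)) + N.expectation B"
    using V V' B aA aD by (simp add: algebra_simps)
  also have "expectation (\<lambda>z. \<theta> z * (f z)\<^sup>2) - expectation (\<lambda>z. \<phi> z * (\<theta> z * f z))
      = expectation (\<lambda>z. \<theta> z * (f z)\<^sup>2 - \<phi> z * (\<theta> z * f z))"
    by (rule Bochner_Integration.integral_diff[symmetric]; intro bounded_var_integrable bu bounded_var_mult bounded_var_parts)
  \<comment> \<open>The weight emerges here: \<open>1 - \<theta> / (\<theta> + m * b) = m * b /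
    (\<theta> + m * b)\<close>.\<close>
  also have "\<dots> = W" unfolding W_def
  proof (rule integral_cong_AE)
    show "AE z in Q. \<theta> z * (f z)\<^sup>2 - \<phi> z * (\<theta> z * f z) =
      real m * b / (\<theta> z + real m * b) * \<theta> z * (u z - g)\<^sup>2"
      using bound_\<theta>
    proof eventually_elim
      case (elim z)
      have "0 < \<theta> z + real m * b" using elim b_ge l_pos by (simp add: add_pos_nonneg)
      then show ?case by (simp add: \<phi>_def f_def field_simps power2_eq_square)
    qed
  qed measurable
  finally have G: "N.expectation (\<lambda>x. (D x)\<^sup>2 / S x) =
    (real m + 1) * (W - expectation (\<lambda>z. \<theta> z * (u z - \<mu>)\<^sup>2)) + N.expectation B" .
  have "X - Y / n + G / n = w" if "G = n * (w - X) + Y" "n \<noteq> 0" for X Y G w n :: real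
    unfolding that(1) using that(2) by (simp add: field_simps)
  from this[OF G] show "expectation (\<lambda>z. \<theta> z * (u z - \<mu>)\<^sup>2)
      - N.expectation (\<lambda>x. (\<Sum>j\<in>J. \<theta> (x j) * (u (x j) - \<mu>))\<^sup>2 / S x) / (real m + 1)
      + N.expectation (\<lambda>x. (D x)\<^sup>2 / S x) / (real m + 1) = W"
    unfolding B_def[abs_def] by simp
qed

section \<open>Sign and vanishing of the gap\<close>

lemma gap_nonneg: "0 \<le> N.expectation (\<lambda>x. (D x)\<^sup>2 / S x)"
  using AE_S by (intro integral_nonneg_AE) (auto elim: eventually_mono)

text \<open>If \<open>D = 0\<close>, test it against \<open>\<phi>(x\<^sub>i) \<eta>(x\<^sub>n)\<close>: the only terms that survive are squares.\<close>
lemma gap_eq_0_imp: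
  assumes "N.expectation (\<lambda>x. (D x)\<^sup>2 / S x) = 0"
  shows "expectation (\<lambda>z. (\<phi> z)\<^sup>2) = 0 \<or> expectation (\<lambda>z. (\<eta> z)\<^sup>2) = 0"
proof -
  have "AE x in N. 0 \<le> (D x)\<^sup>2 / S x" using AE_S by eventually_elim simp
  from integral_nonneg_eq_0_iff_AE[OF information_gap(1) this] assms
  have "AE x in N. (D x)\<^sup>2 / S x = 0" by simp
  with AE_S AE_D have D0: "AE x in N. (\<Sum>j\<in>J. \<Sum>k\<in>J - {j}. \<phi> (x j) * \<eta> (x k)) = 0"
    by eventually_elim auto
  obtain i where i: "i \<in> J" using card_J by fastforce
  \<comment> \<open>Since \<open>m\<close> is positive, the sample contains a second member besides
    \<open>i\<close>.\<close>
  have "J - {i} \<noteq> {}" using card_J m_pos i finite_J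
    by (metis Suc_eq_plus1 card.empty card_Suc_Diff1 less_irrefl nat.inject)
  then obtain n where n: "n \<in> J" "n \<noteq> i" by auto
  define T where "T j k x = \<phi> (x j) * \<eta> (x k) * \<phi> (x i) * \<eta> (x n)" for j k x
  define PP where "PP j k r z = (if r = j then \<phi> z else 1) * (if r = k then \<eta> z else 1) *
    (if r = i then \<phi> z else 1) * (if r = n then \<eta> z else 1)" for j k r z
  have iT: "integrable N (T j k)" if "j \<in> J" "k \<in> J - {j}" for j k
    unfolding T_def[abs_def] using that i n by (intro N_integrable4 bounded_var_parts) auto
  have ET: "N.expectation (T j k) = (\<Prod>r\<in>J. expectation (PP j k r))" if "j \<in> J" "k \<in> J - {j}" for j k
    unfolding T_def[abs_def] PP_def[abs_def] using that i n by (intro N_expectation4 bounded_var_parts) auto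
  have T_nonneg: "0 \<le> N.expectation (T j k)" if jk: "j \<in> J" "k \<in> J - {j}" for j k
  proof -
    \<comment> \<open>If \<open>j\<close> or \<open>k\<close> lies outside \<open>{i, n}\<close>,
      that coordinate carries a lone mean-zero factor. What remains is \<open>(i, n)\<close>, a
      pointwise square, and \<open>(n, i)\<close>, whose mean is the square of the mean of
      \<open>\<phi> * \<eta>\<close>. All terms being nonnegative, a zero total forces the
      \<open>(i, n)\<close> term to vanish.\<close>
    consider "j \<noteq> i" "j \<noteq> n" | "k \<noteq> i" "k \<noteq> n" | "j = i" "k = n" | "j = n" "k = i"
      using jk by auto
    then show ?thesis
    proof cases
      case 1
      then have "expectation (PP j k j) = 0" using jk expectation_\<phi> by (auto simp: PP_def[abs_def])
      then have "(\<Prod>r\<in>J. expectation (PP j k r)) = 0" using jk finite_J by (intro prod_zero) auto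
      with ET[OF jk] show ?thesis by simp
    next
      case 2
      then have "expectation (PP j k k) = 0" using jk expectation_\<eta> by (auto simp: PP_def[abs_def])
      then have "(\<Prod>r\<in>J. expectation (PP j k r)) = 0" using jk finite_J by (intro prod_zero) auto
      with ET[OF jk] show ?thesis by simp
    next
      case 3
      have "0 \<le> T j k x" for x unfolding T_def 3
        by (metis (no_types, lifting) mult.assoc mult.commute zero_le_square)
      then show ?thesis by simp
    next
      case 4
      have "expectation (PP j k r) = (if r = i then expectation (\<lambda>z. \<eta> z * \<phi> z) else 1) *
         (if r = n then expectation (\<lambda>z. \<phi> z * \<eta> z) else 1)" for r
        using n 4 by (auto simp: PP_def[abs_def] prob_space)
      then have "(\<Prod>r\<in>J. expectation (PP j k r)) = expectation (\<lambda>z. \<eta> z * \<phi> z) * expectation (\<lambda>z. \<phi> z * \<eta> z)"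
        using finite_J i n by (simp add: prod.distrib)
      with ET[OF jk] show ?thesis by (simp add: mult.commute)
    qed
  qed
  have "AE x in N. (\<Sum>j\<in>J. \<Sum>k\<in>J - {j}. T j k x) = 0"
    using D0
  proof eventually_elim
    case (elim x)
    have "(\<Sum>j\<in>J. \<Sum>k\<in>J - {j}. T j k x) = (\<Sum>j\<in>J. \<Sum>k\<in>J - {j}. \<phi> (x j) * \<eta> (x k)) * (\<phi> (x i) * \<eta> (x n))"
      by (simp add: T_def sum_distrib_right mult.assoc)
    then show ?case using elim by simp
  qed
  then have "0 = N.expectation (\<lambda>x. \<Sum>j\<in>J. \<Sum>k\<in>J - {j}. T j k x)"
    by (subst integral_cong_AE[where g="\<lambda>_. 0"])
      (auto intro!: borel_measurable_sum borel_measurable_integrable[OF iT])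
  also have "\<dots> = (\<Sum>j\<in>J. N.expectation (\<lambda>x. \<Sum>k\<in>J - {j}. T j k x))"
    by (intro Bochner_Integration.integral_sum Bochner_Integration.integrable_sum iT)
  also have "\<dots> = (\<Sum>j\<in>J. \<Sum>k\<in>J - {j}. N.expectation (T j k))"
    by (intro sum.cong refl Bochner_Integration.integral_sum iT)
  finally have "(\<Sum>j\<in>J. \<Sum>k\<in>J - {j}. N.expectation (T j k)) = 0" by simp
  then have "(\<Sum>k\<in>J - {i}. N.expectation (T i k)) = 0"
    using finite_J i T_nonneg by (subst (asm) sum_nonneg_eq_0_iff) (auto intro!: sum_nonneg)
  then have "N.expectation (T i n) = 0"
    using finite_J i n T_nonneg[OF i] by (subst (asm) sum_nonneg_eq_0_iff) auto
  moreover have "expectation (PP i n r) = (if r = i then expectation (\<lambda>z. (\<phi> z)\<^sup>2) else 1) *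
      (if r = n then expectation (\<lambda>z. (\<eta> z)\<^sup>2) else 1)" for r
    using n by (auto simp: PP_def[abs_def] prob_space power2_eq_square)
  then have "(\<Prod>r\<in>J. expectation (PP i n r)) = expectation (\<lambda>z. (\<phi> z)\<^sup>2) * expectation (\<lambda>z. (\<eta> z)\<^sup>2)"
    using finite_J i n by (simp add: prod.distrib)
  ultimately show ?thesis using ET[OF i, of n] i n by auto
qed

lemma AE_zero_of_square:
  assumes "bounded_var F" "expectation (\<lambda>z. (F z)\<^sup>2) = 0"
  shows "AE z in Q. F z = 0"
proof -
  have "integrable Q (\<lambda>z. (F z)\<^sup>2)"
    unfolding power2_eq_square by (intro bounded_var_integrable bounded_var_mult assms)
  from integral_nonneg_eq_0_iff_AE[OF this] assms(2) show ?thesis by simp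
qed

text \<open>The relation \<open>u = ln \<theta>\<close> singles out the direction
  \<open>\<beta>\<close>, in which constancy of the weights passes on to \<open>u\<close>.\<close>

lemma gap_eq_0_imp_W_eq_0:
  assumes gap: "N.expectation (\<lambda>x. (D x)\<^sup>2 / S x) = 0" and u: "AE z in Q. u z = ln (\<theta> z)"
  shows "W = 0"
proof -
  have "AE z in Q. f z = 0"
    using gap_eq_0_imp[OF gap]
  proof
    assume "expectation (\<lambda>z. (\<phi> z)\<^sup>2) = 0"
    from AE_zero_of_square[OF _ this] have "AE z in Q. \<phi> z = 0" by simp
    with bound_\<theta> show ?thesis
    proof eventually_elim
      case (elim z)
      have "0 < \<theta> z + real m * b" using elim b_ge l_pos by (simp add: add_pos_nonneg)
      then show ?case using elim l_pos by (auto simp: \<phi>_def)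
    qed
  next
    assume "expectation (\<lambda>z. (\<eta> z)\<^sup>2) = 0"
    from AE_zero_of_square[OF _ this] have "AE z in Q. \<eta> z = 0" by simp
    with u have fc: "AE z in Q. f z = ln b - g \<and> \<phi> z = b * (ln b - g) / (b + real m * b)"
      by eventually_elim (simp add: \<eta>_def f_def \<phi>_def)
    \<comment> \<open>Here \<open>\<phi>\<close> is constant and has mean zero, so the constant
      value \<open>ln b\<close> of \<open>u\<close> must be \<open>g\<close>.\<close>
    then have "expectation \<phi> = expectation (\<lambda>_. b * (ln b - g) / (b + real m * b))"
      by (intro integral_cong_AE) auto
    then have "b * (ln b - g) / (b + real m * b) = 0"
      using expectation_\<phi> by (simp add: prob_space)
    moreover have "0 < b" "0 < b + real m * b" using b_ge l_pos by (auto intro: add_pos_nonneg)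
    ultimately have "ln b - g = 0" by auto
    with fc show ?thesis by auto
  qed
  then have "AE z in Q. real m * b / (\<theta> z + real m * b) * \<theta> z * (u z - g)\<^sup>2 = 0"
    by eventually_elim (simp add: f_def)
  then show ?thesis unfolding W_def by (subst integral_cong_AE[where g="\<lambda>_. 0"]) auto
qed

lemma gap_eq_0_if_const:
  assumes "AE z in Q. \<theta> z = k"
  shows "N.expectation (\<lambda>x. (D x)\<^sup>2 / S x) = 0"
proof -
  have "b = expectation (\<lambda>_. k)" unfolding b_def using assms by (intro integral_cong_AE) auto
  then have "b = k" by (simp add: prob_space)
  with assms have "AE z in Q. \<eta> z = 0" by (simp add: \<eta>_def)
  from AE_N[OF this] AE_D have "AE x in N. (D x)\<^sup>2 / S x = 0"
    by eventually_elim simp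
  then show ?thesis by (subst integral_cong_AE[where g="\<lambda>_. 0"]) auto
qed

end

section \<open>Quadratic forms\<close>

text \<open>Lets a quadratic form pass through a Bochner integral of matrices, so that matrices can
  be compared through scalar integrals.\<close>

lemma bounded_linear_quadratic_form: "bounded_linear (\<lambda>A :: real^'n^'n. x \<bullet> (A *v x))"
proof -
  have "linear (\<lambda>A :: real^'n^'n. x \<bullet> (A *v x))"
    by (rule linearI)
      (simp_all add: matrix_vector_mult_add_rdistrib inner_add_right scaleR_matrix_vector_assoc[symmetric])
  then show ?thesis by (simp add: linear_conv_bounded_linear)
qed

lemma inner_outer2_mult: "x \<bullet> (outer2 v *v x) = (x \<bullet> v)\<^sup>2"
proof -
  have "outer2 v *v x = (v \<bullet> x) *\<^sub>R v"
    by (simp add: vec_eq_iff outer2_def matrix_vector_mult_def inner_vec_def sum_distrib_left sum_distrib_right mult_ac)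
  then show ?thesis by (simp add: power2_eq_square inner_commute)
qed

lemma norm_outer2: "norm (outer2 v) = (norm v)\<^sup>2"
proof -
  have "outer2 v $ i = (v $ i) *\<^sub>R v" for i by (simp add: vec_eq_iff outer2_def)
  then have "norm (outer2 v) = L2_set (\<lambda>i. norm (v $ i) * norm v) UNIV"
    by (simp add: norm_vec_def[of "outer2 v"])
  also have "\<dots> = norm v * norm v"
    by (simp add: L2_set_left_distrib[symmetric] norm_vec_def[of v])
  finally show ?thesis by (simp add: power2_eq_square)
qed

lemma borel_measurable_outer2[measurable]: "outer2 \<in> borel_measurable borel"
  unfolding outer2_def[abs_def]
  by (intro borel_measurable_continuous_onI continuous_intros continuous_on_vec_lambda)

text \<open>\<open>matrix_inv\<close> is given by Hilbert choice, so both identities rest on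
  invertibility, which follows from the trivial kernel.\<close>

lemma pos_def_inverse:
  assumes "pos_def A"
  shows "A ** matrix_inv A = mat 1" "matrix_inv A ** A = mat 1"
proof -
  have "x = 0" if "A *v x = 0" for x
    using assms that by (auto simp: pos_def_def)
  then have "invertible A"
    by (simp add: invertible_left_inverse matrix_left_invertible_ker)
  then have "A ** matrix_inv A = mat 1 \<and> matrix_inv A ** A = mat 1"
    unfolding invertible_def matrix_inv_def by (rule someI_ex)
  then show "A ** matrix_inv A = mat 1" "matrix_inv A ** A = mat 1" by auto
qed

lemma symmetric_matrix_inv:
  assumes "pos_def A" shows "transpose (matrix_inv A) = matrix_inv A"
proof -
  have "transpose (matrix_inv A) ** A = mat 1"
    using arg_cong[OF pos_def_inverse(1)[OF assms], of transpose] assms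
    by (simp add: matrix_transpose_mul transpose_mat pos_def_def)
  then have "(transpose (matrix_inv A) ** A) ** matrix_inv A = matrix_inv A" by simp
  then show ?thesis
    unfolding matrix_mul_assoc[symmetric] pos_def_inverse(1)[OF assms] by simp
qed

lemma inner_symmetric_matrix: "transpose A = A \<Longrightarrow> x \<bullet> (A *v y) = y \<bullet> (A *v (x::real^'n))"
  using dot_lmul_matrix[of x A y] transpose_matrix_vector[of A x] by (simp add: inner_commute)

text \<open>The form of the inverse of \<open>P\<close> at \<open>y\<close> is the maximum over
  \<open>a\<close> of \<open>2 * (y \<bullet> a) - a \<bullet> (P *v a)\<close>. Taking
  \<open>a = matrix_inv S *v y\<close> and using \<open>a \<bullet> (P *v a) \<le> a \<bullet> (S *v
  a) = y \<bullet> a\<close> leaves at least \<open>y \<bullet> a\<close>. No square roots of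
  matrices enter.\<close>

lemma nonneg_def_diff_matrix_inv:
  assumes P: "pos_def P" and S: "pos_def S"
    and le: "\<And>x. x \<bullet> (P *v x) \<le> x \<bullet> (S *v x)"
  shows "nonneg_def (matrix_inv P - matrix_inv S)"
  unfolding nonneg_def_def
proof (intro conjI allI)
  show "transpose (matrix_inv P - matrix_inv S) = matrix_inv P - matrix_inv S"
    using symmetric_matrix_inv[OF P] symmetric_matrix_inv[OF S]
    by (simp add: transpose_def vec_eq_iff)
  fix y :: "real^'a"
  define p where "p = matrix_inv P *v y"
  define a where "a = matrix_inv S *v y"
  have Pp: "P *v p = y" and Sa: "S *v a = y"
    unfolding p_def a_def
    by (simp_all add: matrix_vector_mul_assoc pos_def_inverse[OF P] pos_def_inverse[OF S])
  have "0 \<le> (p - a) \<bullet> (P *v (p - a))"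
    using P unfolding pos_def_def by (cases "p - a = 0") (auto intro: less_imp_le)
  also have "\<dots> = y \<bullet> p - 2 * (y \<bullet> a) + a \<bullet> (P *v a)"
    using inner_symmetric_matrix[of P p a] P Pp unfolding pos_def_def
    by (simp add: matrix_vector_mult_diff_distrib inner_diff_left inner_diff_right inner_commute)
  also have "\<dots> \<le> y \<bullet> p - y \<bullet> a"
    using le[of a] Sa by (simp add: inner_commute)
  finally show "0 \<le> y \<bullet> ((matrix_inv P - matrix_inv S) *v y)"
    by (simp add: p_def a_def matrix_vector_mult_diff_rdistrib inner_diff_right)
qed

lemma pos_def_matrix_inv_inject:
  assumes "pos_def P" "pos_def S" "matrix_inv P = matrix_inv S"
  shows "P = S"
proof -
  have "P = P ** (matrix_inv S ** S)" using pos_def_inverse(2)[OF assms(2)] by simp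
  also have "\<dots> = (P ** matrix_inv P) ** S" using assms(3) by (simp add: matrix_mul_assoc)
  finally show ?thesis using pos_def_inverse(1)[OF assms(1)] by simp
qed

text \<open>Polarization: symmetry recovers the bilinear form from the quadratic one.\<close>

lemma symmetric_matrix_eqI:
  fixes P S :: "real^'n^'n"
  assumes P: "transpose P = P" and S: "transpose S = S" and eq: "\<And>x. x \<bullet> (P *v x) = x \<bullet> (S *v x)"
  shows "P = S"
proof -
  have "x \<bullet> (P *v y) = x \<bullet> (S *v y)" for x y
    using eq[of "x + y"] eq[of x] eq[of y] inner_symmetric_matrix[OF P, of x y] inner_symmetric_matrix[OF S, of x y]
    by (simp add: matrix_vector_right_distrib inner_add_left inner_add_right)
  then have "P *v y = S *v y" for y using vector_eq_ldot by blast
  then show ?thesis by (simp add: matrix_eq)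
qed

lemma (in prob_space)
  fixes F :: "'a \<Rightarrow> 'c::{banach, second_countable_topology}"
  assumes "F \<in> borel_measurable M" "AE x in M. norm (F x) \<le> B"
  shows integrable_AE_norm_bounded: "integrable M F"
    and norm_expectation_le: "norm (integral\<^sup>L M F) \<le> B"
proof -
  show i: "integrable M F" by (rule integrable_const_bound[OF assms(2,1)])
  have "norm (integral\<^sup>L M F) \<le> (\<integral>x. norm (F x) \<partial>M)" by (rule integral_norm_bound)
  also have "\<dots> \<le> (\<integral>x. B \<partial>M)" using assms i by (intro integral_mono_AE) auto
  finally show "norm (integral\<^sup>L M F) \<le> B" by (simp add: prob_space)
qed

text \<open>Elementary conditioning becomes integration against a probability measure, whose image
  under the covariates is then available as a law.\<close>

lemma cond_expect_eq_integral_uniform_measure: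
  assumes "A \<in> sets M" "0 < measure M A" "X \<in> borel_measurable M"
  shows "cond_expect M X A = integral\<^sup>L (uniform_measure M A) X"
proof -
  have fin: "emeasure M A = ennreal (measure M A)"
    using assms(2) by (intro emeasure_eq_ennreal_measure) (auto simp: measure_def)
  have "(indicator A x / emeasure M A :: ennreal) = ennreal (indicator A x / measure M A)" for x
    using assms(2) unfolding fin by (simp add: divide_ennreal[symmetric] ennreal_indicator)
  then have "uniform_measure M A = density M (\<lambda>x. ennreal (indicator A x / measure M A))"
    unfolding uniform_measure_def by simp
  then have "integral\<^sup>L (uniform_measure M A) X = (\<integral>x. (indicator A x / measure M A) *\<^sub>R X x \<partial>M)"
    using assms by (simp add: integral_density)
  also have "\<dots> = (\<integral>x. (1 / measure M A) *\<^sub>R (indicator A x *\<^sub>R X x) \<partial>M)" by simp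
  also have "\<dots> = cond_expect M X A"
    unfolding cond_expect_def set_lebesgue_integral_def using assms(2)
    by (subst integral_scaleR_right) (simp_all add: inverse_eq_divide)
  finally show ?thesis by simp
qed

section \<open>Information at a fixed time\<close>

definition cox_information ::
    "'a measure \<Rightarrow> ('a \<Rightarrow> real) \<Rightarrow> (real \<Rightarrow> 'a \<Rightarrow> real ^ 'd) \<Rightarrow> real ^ 'd \<Rightarrow> real \<Rightarrow> real ^ 'd ^ 'd"
  where
  "cox_information M Y Z \<beta> t =
     (LINT \<omega>|M. (exp (\<beta> \<bullet> Z t \<omega>) * at_risk Y t \<omega>) *\<^sub>R outer2 (Z t \<omega> - mu_fun M Y Z \<beta> t))"

text \<open>The hazard and the factor \<open>1 / (m + 1)\<close> are left outside, but the
  probability of being at risk is kept: it is the common factor that \<open>cox_information\<close>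
  and \<open>weighted_information\<close> carry through \<open>at_risk\<close>.\<close>

definition sampling_loss ::
    "'a measure \<Rightarrow> ('a \<Rightarrow> real) \<Rightarrow> (real \<Rightarrow> 'a \<Rightarrow> real ^ 'd) \<Rightarrow>
     (nat \<Rightarrow> 'a \<Rightarrow> real) \<Rightarrow> (nat \<Rightarrow> real \<Rightarrow> 'a \<Rightarrow> real ^ 'd) \<Rightarrow>
     real ^ 'd \<Rightarrow> nat \<Rightarrow> real \<Rightarrow> real ^ 'd ^ 'd"
  where
  "sampling_loss M Y Z Ys Zs \<beta> m t =
     measure M {\<omega>\<in>space M. t \<le> Y \<omega>} *\<^sub>R
     cond_expect M
       (\<lambda>\<omega>. outer2 (\<Sum>j=1..m+1. exp (\<beta> \<bullet> Zs j t \<omega>) *\<^sub>R (Zs j t \<omega> - mu_fun M Y Z \<beta> t)) /\<^sub>R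
             (\<Sum>j=1..m+1. exp (\<beta> \<bullet> Zs j t \<omega>)))
       {\<omega>\<in>space M. \<forall>j\<in>{1..m+1}. t \<le> Ys j \<omega>}"

definition weighted_information ::
    "'a measure \<Rightarrow> ('a \<Rightarrow> real) \<Rightarrow> (real \<Rightarrow> 'a \<Rightarrow> real ^ 'd) \<Rightarrow> real ^ 'd \<Rightarrow> nat \<Rightarrow> real \<Rightarrow> real ^ 'd ^ 'd"
  where
  "weighted_information M Y Z \<beta> m t =
     (LINT \<omega>|M. (w_fun M Y Z \<beta> m t \<omega> * exp (\<beta> \<bullet> Z t \<omega>) * at_risk Y t \<omega>) *\<^sub>R
                 outer2 (Z t \<omega> - g_fun M Y Z \<beta> m t))"

text \<open>
  \<open>rectangles\<close> is all that is used of the i.i.d. assumption: it makes the sampled covariates, given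
  that all are at risk, independent with the law of \<open>Z t\<close> given \<open>t \<le> Y\<close>.
\<close>
locale risk_set = prob_space M for M :: "'a measure" +
  fixes Y :: "'a \<Rightarrow> real" and Z :: "real \<Rightarrow> 'a \<Rightarrow> real ^ 'd"
    and Ys :: "nat \<Rightarrow> 'a \<Rightarrow> real" and Zs :: "nat \<Rightarrow> real \<Rightarrow> 'a \<Rightarrow> real ^ 'd"
    and \<beta> :: "real ^ 'd" and c :: real and m :: nat and t :: real
  assumes measurable_Z[measurable]: "Z t \<in> borel_measurable M"
    and measurable_Y[measurable]: "Y \<in> borel_measurable M"
    and measurable_Zs: "\<And>j. j \<in> {1..m+1} \<Longrightarrow> Zs j t \<in> borel_measurable M"
    and measurable_Ys: "\<And>j. j \<in> {1..m+1} \<Longrightarrow> Ys j \<in> borel_measurable M"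
    and at_risk_pos: "0 < prob {\<omega>\<in>space M. t \<le> Y \<omega>}"
    and bounded_Z: "AE \<omega> in M. norm (Z t \<omega>) \<le> c"
    and c_nonneg: "0 \<le> c" and m_pos: "0 < m"
    and rectangles: "\<And>A. (\<And>j. j \<in> {1..m+1} \<Longrightarrow> A j \<in> sets borel) \<Longrightarrow>
      prob {\<omega>\<in>space M. \<forall>j\<in>{1..m+1}. t \<le> Ys j \<omega> \<and> Zs j t \<omega> \<in> A j} =
      (\<Prod>j\<in>{1..m+1}. prob {\<omega>\<in>space M. t \<le> Y \<omega> \<and> Z t \<omega> \<in> A j})"
begin

abbreviation "J \<equiv> {1..m+1}"
definition "R = {\<omega>\<in>space M. t \<le> Y \<omega>}"
definition "Rs = {\<omega>\<in>space M. \<forall>j\<in>J. t \<le> Ys j \<omega>}"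
definition "Q = distr (uniform_measure M R) borel (Z t)"
definition "\<theta> z = exp (\<beta> \<bullet> z)"
definition "\<mu> = mu_fun M Y Z \<beta> t"
definition "g = g_fun M Y Z \<beta> m t"
definition "w z = real m * (\<integral>z. \<theta> z \<partial>Q) / (\<theta> z + real m * (\<integral>z. \<theta> z \<partial>Q))"

lemma measurable_R[measurable]: "R \<in> sets M"
  unfolding R_def by measurable

lemma measurable_Rs[measurable]: "Rs \<in> sets M"
proof -
  have "Rs = (\<Inter>j\<in>J. {\<omega>\<in>space M. t \<le> Ys j \<omega>})" by (auto simp: Rs_def)
  also have "\<dots> \<in> sets M"
    using measurable_Ys by (intro sets.finite_INT) auto
  finally show ?thesis .
qed

lemma prob_R_pos: "0 < prob R"
  using at_risk_pos by (simp add: R_def)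

lemma emeasure_R: "emeasure M R \<noteq> 0" "emeasure M R \<noteq> \<infinity>"
  using prob_R_pos by (auto simp: emeasure_eq_measure)

text \<open>The full rectangle \<open>A j = UNIV\<close> reduces \<open>rectangles\<close> to the
  at-risk events alone; the conditioning event in \<open>sampling_loss\<close> thus has positive
  probability.\<close>

lemma prob_Rs: "prob Rs = prob R ^ (m + 1)"
  using rectangles[of "\<lambda>_. UNIV"] by (simp add: Rs_def R_def)

lemma prob_Rs_pos: "0 < prob Rs"
  using prob_R_pos by (simp add: prob_Rs)

sublocale Q: prob_space Q
  unfolding Q_def
  by (intro prob_space.prob_space_distr prob_space_uniform_measure emeasure_R) measurable

lemma sets_Q[measurable_cong, simp]: "sets Q = sets borel"
  unfolding Q_def by simp

lemma space_Q[simp]: "space Q = UNIV"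
  unfolding Q_def by simp

lemma measurable_\<theta>[measurable]: "\<theta> \<in> borel_measurable borel"
  unfolding \<theta>_def[abs_def] by measurable

lemma measurable_w[measurable]: "w \<in> borel_measurable borel"
  unfolding w_def[abs_def] by measurable

lemma AE_Q_norm: "AE z in Q. norm z \<le> c"
proof -
  have "AE \<omega> in uniform_measure M R. norm (Z t \<omega>) \<le> c"
    using bounded_Z emeasure_R by (intro AE_uniform_measureI) auto
  then show ?thesis unfolding Q_def by (subst AE_distr_iff) auto
qed

text \<open>The bridge from \<open>M\<close> to \<open>Q\<close>. The factor \<open>prob R\<close>
  cancels in the quotients \<open>mu_fun\<close> and \<open>g_fun\<close> and survives in the three
  information matrices.\<close>

lemma integral_at_risk:
  fixes F :: "real ^ 'd \<Rightarrow> 'e::{banach, second_countable_topology}"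
  assumes [measurable]: "F \<in> borel_measurable borel"
  shows "(\<integral>\<omega>. at_risk Y t \<omega> *\<^sub>R F (Z t \<omega>) \<partial>M) = prob R *\<^sub>R (\<integral>z. F z \<partial>Q)"
proof -
  have "(\<integral>z. F z \<partial>Q) = (\<integral>\<omega>. F (Z t \<omega>) \<partial>uniform_measure M R)"
    unfolding Q_def by (rule integral_distr) measurable
  also have "\<dots> = cond_expect M (\<lambda>\<omega>. F (Z t \<omega>)) R"
    by (intro cond_expect_eq_integral_uniform_measure[symmetric] prob_R_pos) measurable
  also have "\<dots> = (\<integral>\<omega>. at_risk Y t \<omega> *\<^sub>R F (Z t \<omega>) \<partial>M) /\<^sub>R prob R"
    unfolding cond_expect_def set_lebesgue_integral_def
    by (intro arg_cong2[where f=scaleR] refl Bochner_Integration.integral_cong)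
      (auto simp: at_risk_def R_def)
  finally show ?thesis using prob_R_pos by simp
qed

lemma b_fun_eq: "b_fun M Y Z \<beta> t = (\<integral>z. \<theta> z \<partial>Q)"
proof -
  have "b_fun M Y Z \<beta> t = cond_expect M (\<lambda>\<omega>. \<theta> (Z t \<omega>)) R"
    by (simp add: b_fun_def R_def \<theta>_def)
  also have "\<dots> = (\<integral>\<omega>. \<theta> (Z t \<omega>) \<partial>uniform_measure M R)"
    by (intro cond_expect_eq_integral_uniform_measure prob_R_pos) measurable
  also have "\<dots> = (\<integral>z. \<theta> z \<partial>Q)"
    unfolding Q_def by (rule integral_distr[symmetric]) measurable
  finally show ?thesis .
qed

lemma w_fun_eq: "w_fun M Y Z \<beta> m t \<omega> = w (Z t \<omega>)"
  unfolding w_fun_def w_def b_fun_eq \<theta>_def ..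

lemma \<mu>_eq: "\<mu> = (\<integral>z. \<theta> z *\<^sub>R z \<partial>Q) /\<^sub>R (\<integral>z. \<theta> z \<partial>Q)"
proof -
  have "(\<integral>\<omega>. (exp (\<beta> \<bullet> Z t \<omega>) * at_risk Y t \<omega>) *\<^sub>R Z t \<omega> \<partial>M) = prob R *\<^sub>R (\<integral>z. \<theta> z *\<^sub>R z \<partial>Q)"
    using integral_at_risk[of "\<lambda>z. \<theta> z *\<^sub>R z"] by (simp add: \<theta>_def mult.commute)
  moreover have "(\<integral>\<omega>. exp (\<beta> \<bullet> Z t \<omega>) * at_risk Y t \<omega> \<partial>M) = prob R * (\<integral>z. \<theta> z \<partial>Q)"
    using integral_at_risk[of "\<lambda>z. \<theta> z"] by (simp add: \<theta>_def mult.commute)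
  ultimately show ?thesis using prob_R_pos by (simp add: \<mu>_def mu_fun_def)
qed

lemma g_eq: "g = (\<integral>z. (w z * \<theta> z) *\<^sub>R z \<partial>Q) /\<^sub>R (\<integral>z. w z * \<theta> z \<partial>Q)"
proof -
  have "(\<integral>\<omega>. (w (Z t \<omega>) * exp (\<beta> \<bullet> Z t \<omega>) * at_risk Y t \<omega>) *\<^sub>R Z t \<omega> \<partial>M)
      = prob R *\<^sub>R (\<integral>z. (w z * \<theta> z) *\<^sub>R z \<partial>Q)"
    using integral_at_risk[of "\<lambda>z. (w z * \<theta> z) *\<^sub>R z"] by (simp add: \<theta>_def mult_ac)
  moreover have "(\<integral>\<omega>. w (Z t \<omega>) * exp (\<beta> \<bullet> Z t \<omega>) * at_risk Y t \<omega> \<partial>M) = prob R * (\<integral>z. w z * \<theta> z \<partial>Q)"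
    using integral_at_risk[of "\<lambda>z. w z * \<theta> z"] by (simp add: \<theta>_def mult_ac)
  ultimately show ?thesis using prob_R_pos by (simp add: g_def g_fun_def w_fun_eq)
qed

abbreviation "Cox \<equiv> cox_information M Y Z \<beta> t"
abbreviation "Loss \<equiv> sampling_loss M Y Z Ys Zs \<beta> m t"
abbreviation "Weighted \<equiv> weighted_information M Y Z \<beta> m t"

lemma cox_information_eq: "Cox = prob R *\<^sub>R (\<integral>z. \<theta> z *\<^sub>R outer2 (z - \<mu>) \<partial>Q)"
  using integral_at_risk[of "\<lambda>z. \<theta> z *\<^sub>R outer2 (z - \<mu>)"]
  by (simp add: cox_information_def \<mu>_def \<theta>_def mult.commute)

lemma weighted_information_eq:
  "Weighted = prob R *\<^sub>R (\<integral>z. (w z * \<theta> z) *\<^sub>R outer2 (z - g) \<partial>Q)"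
  using integral_at_risk[of "\<lambda>z. (w z * \<theta> z) *\<^sub>R outer2 (z - g)"]
  by (simp add: weighted_information_def g_def \<theta>_def w_fun_eq mult_ac)

section \<open>Law of the sampled covariates given that all are at risk\<close>

sublocale prod: product_sigma_finite "\<lambda>_::nat. Q" ..

text \<open>A law on a finite product is fixed by its values on rectangles. As
  \<open>prob Rs\<close> is \<open>prob R\<close> to the power \<open>m + 1\<close>, the
  normalisation splits into one division by \<open>prob R\<close> per coordinate, and each quotient
  is a \<open>Q\<close>-probability.\<close>

lemma distr_risk_set_sample:
  "distr (uniform_measure M Rs) (Pi\<^sub>M J (\<lambda>_. borel)) (\<lambda>\<omega>. \<lambda>j\<in>J. Zs j t \<omega>) = Pi\<^sub>M J (\<lambda>_. Q)" (is "?L = _")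
proof (rule prod.PiM_eqI)
  have mX: "(\<lambda>\<omega>. \<lambda>j\<in>J. Zs j t \<omega>) \<in> measurable M (Pi\<^sub>M J (\<lambda>_. borel))"
    by (intro measurable_restrict measurable_Zs)
  show "sets ?L = sets (Pi\<^sub>M J (\<lambda>_. Q))"
    by (simp cong: sets_PiM_cong)
  fix A :: "nat \<Rightarrow> (real ^ 'd) set" assume "\<And>j. j \<in> J \<Longrightarrow> A j \<in> sets Q"
  then have A: "\<And>j. j \<in> J \<Longrightarrow> A j \<in> sets borel" by simp
  define B where "B = {\<omega>\<in>space M. \<forall>j\<in>J. t \<le> Ys j \<omega> \<and> Zs j t \<omega> \<in> A j}"
  define V where "V = (\<lambda>\<omega>. \<lambda>j\<in>J. Zs j t \<omega>) -` (Pi\<^sub>E J A) \<inter> space M"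
  have V: "V \<in> sets M"
    unfolding V_def by (rule measurable_sets[OF mX]) (auto intro!: sets_PiM_I_finite A)
  have "emeasure ?L (Pi\<^sub>E J A) = emeasure (uniform_measure M Rs) V"
    using mX A by (subst emeasure_distr) (auto simp: V_def intro!: sets_PiM_I_finite)
  also have "\<dots> = emeasure M (Rs \<inter> V) / emeasure M Rs"
    by (rule emeasure_uniform_measure) (simp_all add: V)
  also have "Rs \<inter> V = B"
    by (auto simp: Rs_def V_def B_def PiE_iff)
  also have "emeasure M B / emeasure M Rs = ennreal (prob B / prob Rs)"
    using prob_Rs_pos by (simp add: emeasure_eq_measure divide_ennreal)
  also have "prob B / prob Rs = (\<Prod>j\<in>J. prob {\<omega>\<in>space M. t \<le> Y \<omega> \<and> Z t \<omega> \<in> A j} / prob R)"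
    unfolding B_def prob_Rs by (subst rectangles[OF A]) (auto simp: prod_dividef)
  also have "ennreal \<dots> = (\<Prod>j\<in>J. ennreal (prob {\<omega>\<in>space M. t \<le> Y \<omega> \<and> Z t \<omega> \<in> A j} / prob R))"
    using prob_R_pos by (intro prod_ennreal[symmetric]) auto
  also have "\<dots> = (\<Prod>j\<in>J. emeasure Q (A j))"
  proof (intro prod.cong refl)
    fix j assume j: "j \<in> J"
    have [measurable]: "A j \<in> sets borel" using A[OF j] .
    have "emeasure Q (A j) = emeasure (uniform_measure M R) (Z t -` A j \<inter> space M)"
      unfolding Q_def by (subst emeasure_distr) auto
    also have "\<dots> = emeasure M (R \<inter> (Z t -` A j \<inter> space M)) / emeasure M R"
      by (rule emeasure_uniform_measure) measurable
    also have "R \<inter> (Z t -` A j \<inter> space M) = {\<omega>\<in>space M. t \<le> Y \<omega> \<and> Z t \<omega> \<in> A j}"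
      by (auto simp: R_def)
    finally show "ennreal (prob {\<omega>\<in>space M. t \<le> Y \<omega> \<and> Z t \<omega> \<in> A j} / prob R) = emeasure Q (A j)"
      using prob_R_pos by (simp add: emeasure_eq_measure divide_ennreal)
  qed
  finally show "emeasure ?L (Pi\<^sub>E J A) = (\<Prod>j\<in>J. emeasure Q (A j))" .
qed auto

lemma cond_expect_sample:
  fixes F :: "(nat \<Rightarrow> real ^ 'd) \<Rightarrow> 'e::{banach, second_countable_topology}"
  assumes F: "F \<in> borel_measurable (Pi\<^sub>M J (\<lambda>_. borel))"
  shows "cond_expect M (\<lambda>\<omega>. F (\<lambda>j\<in>J. Zs j t \<omega>)) Rs = (\<integral>x. F x \<partial>Pi\<^sub>M J (\<lambda>_. Q))"
proof -
  have mX: "(\<lambda>\<omega>. \<lambda>j\<in>J. Zs j t \<omega>) \<in> measurable M (Pi\<^sub>M J (\<lambda>_. borel))"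
    by (intro measurable_restrict measurable_Zs)
  have "cond_expect M (\<lambda>\<omega>. F (\<lambda>j\<in>J. Zs j t \<omega>)) Rs
      = (\<integral>\<omega>. F (\<lambda>j\<in>J. Zs j t \<omega>) \<partial>uniform_measure M Rs)"
    by (intro cond_expect_eq_integral_uniform_measure prob_Rs_pos measurable_compose[OF mX F]) simp
  also have "\<dots> = (\<integral>x. F x \<partial>distr (uniform_measure M Rs) (Pi\<^sub>M J (\<lambda>_. borel)) (\<lambda>\<omega>. \<lambda>j\<in>J. Zs j t \<omega>))"
    by (rule integral_distr[OF _ F, symmetric])
      (use mX measurable_cong_sets[OF sets_uniform_measure refl] in blast)
  finally show ?thesis unfolding distr_risk_set_sample .
qed

definition "G x = outer2 (\<Sum>j\<in>J. \<theta> (x j) *\<^sub>R (x j - \<mu>)) /\<^sub>R (\<Sum>j\<in>J. \<theta> (x j))"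

lemma measurable_G[measurable]: "G \<in> borel_measurable (Pi\<^sub>M J (\<lambda>_. borel))"
  unfolding G_def[abs_def] by measurable

lemma sampling_loss_eq: "Loss = prob R *\<^sub>R (\<integral>x. G x \<partial>Pi\<^sub>M J (\<lambda>_. Q))"
proof -
  have "G (\<lambda>j\<in>J. Zs j t \<omega>) =
      outer2 (\<Sum>j=1..m+1. exp (\<beta> \<bullet> Zs j t \<omega>) *\<^sub>R (Zs j t \<omega> - mu_fun M Y Z \<beta> t)) /\<^sub>R
        (\<Sum>j=1..m+1. exp (\<beta> \<bullet> Zs j t \<omega>))" for \<omega>
    unfolding G_def \<theta>_def \<mu>_def
    by (intro arg_cong2[where f="\<lambda>a b. outer2 a /\<^sub>R b"] sum.cong refl) (simp_all del: sum.cl_ivl_Suc)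
  then show ?thesis
    unfolding cond_expect_sample[OF measurable_G, symmetric] sampling_loss_def R_def Rs_def by presburger
qed

section \<open>Bounds uniform in time, and quadratic forms\<close>

lemma AE_Q_\<theta>: "AE z in Q. exp (- (norm \<beta> * c)) \<le> \<theta> z \<and> \<theta> z \<le> exp (norm \<beta> * c)"
  using AE_Q_norm
proof eventually_elim
  case (elim z)
  have "\<bar>\<beta> \<bullet> z\<bar> \<le> norm \<beta> * norm z" by (rule Cauchy_Schwarz_ineq2)
  also have "\<dots> \<le> norm \<beta> * c" using elim by (intro mult_left_mono) auto
  finally show ?case by (auto simp: \<theta>_def)
qed

lemma \<theta>_pos: "0 < \<theta> z" by (simp add: \<theta>_def)

lemma integrable_\<theta>: "integrable Q \<theta>"
  by (rule Q.integrable_AE_norm_bounded[where B="exp (norm \<beta> * c)"])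
    (use AE_Q_\<theta> in \<open>auto elim!: eventually_mono simp: abs_of_pos[OF \<theta>_pos]\<close>)

lemma expectation_\<theta>_pos: "0 < (\<integral>z. \<theta> z \<partial>Q)"
proof -
  have "exp (- (norm \<beta> * c)) = (\<integral>z. exp (- (norm \<beta> * c)) \<partial>Q)" using Q.prob_space by simp
  also have "\<dots> \<le> (\<integral>z. \<theta> z \<partial>Q)"
    using AE_Q_\<theta> integrable_\<theta> by (intro integral_mono_AE) auto
  finally show ?thesis by (rule less_le_trans[OF exp_gt_zero])
qed

lemma w_bounds: "0 < w z" "w z \<le> 1"
proof -
  have "0 < real m * (\<integral>z. \<theta> z \<partial>Q)" using expectation_\<theta>_pos m_pos by simp
  then show "0 < w z" "w z \<le> 1"
    using \<theta>_pos[of z] unfolding w_def by (simp_all add: add_pos_pos)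
qed

text \<open>\<open>\<mu>\<close> is a weighted mean of vectors in the ball of radius
  \<open>c\<close>. Hence \<open>z - \<mu>\<close> is bounded by \<open>c + c\<close> whatever the
  time, as integrability over time requires.\<close>

lemma norm_\<mu>_le: "norm \<mu> \<le> c"
proof -
  have "norm (\<integral>z. \<theta> z *\<^sub>R z \<partial>Q) \<le> (\<integral>z. norm (\<theta> z *\<^sub>R z) \<partial>Q)" by (rule integral_norm_bound)
  also have "\<dots> \<le> (\<integral>z. c * \<theta> z \<partial>Q)"
  proof (rule integral_mono_AE')
    show "AE z in Q. norm (\<theta> z *\<^sub>R z) \<le> c * \<theta> z"
      using AE_Q_norm by eventually_elim (simp add: abs_of_pos[OF \<theta>_pos] \<theta>_pos mult.commute)
  qed (use integrable_\<theta> c_nonneg \<theta>_pos in \<open>auto simp: less_imp_le\<close>)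
  also have "\<dots> = c * (\<integral>z. \<theta> z \<partial>Q)" by simp
  finally show ?thesis using expectation_\<theta>_pos
    by (simp add: \<mu>_eq abs_of_pos divide_simps mult.commute)
qed

text \<open>A general weight \<open>v\<close> below \<open>\<theta>\<close> covers both
  \<open>\<theta>\<close> itself and \<open>w * \<theta>\<close>.\<close>

lemma integrable_weighted_outer2:
  assumes [measurable]: "v \<in> borel_measurable borel"
    and v: "AE z in Q. 0 \<le> v z \<and> v z \<le> \<theta> z" and a: "norm a \<le> B"
  shows "integrable Q (\<lambda>z. v z *\<^sub>R outer2 (z - a))" (is ?I)
    and "norm (\<integral>z. v z *\<^sub>R outer2 (z - a) \<partial>Q) \<le> exp (norm \<beta> * c) * (c + B)\<^sup>2" (is ?N)
proof -
  have "AE z in Q. norm (v z *\<^sub>R outer2 (z - a)) \<le> exp (norm \<beta> * c) * (c + B)\<^sup>2"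
    using AE_Q_norm AE_Q_\<theta> v
  proof eventually_elim
    case (elim z)
    have "norm (z - a) \<le> c + B" using elim a norm_triangle_ineq4[of z a] by linarith
    then show ?case using elim by (auto simp: norm_outer2 intro!: mult_mono power_mono)
  qed
  then show ?I ?N
    by (rule Q.integrable_AE_norm_bounded[rotated] Q.norm_expectation_le[rotated]; simp)+
qed

lemma quadratic_form_weighted_outer2:
  assumes "v \<in> borel_measurable borel" "AE z in Q. 0 \<le> v z \<and> v z \<le> \<theta> z"
  shows "x \<bullet> ((r *\<^sub>R (\<integral>z. v z *\<^sub>R outer2 (z - a) \<partial>Q)) *v x) = r * (\<integral>z. v z * (x \<bullet> z - x \<bullet> a)\<^sup>2 \<partial>Q)"
proof -
  have "(\<integral>z. x \<bullet> ((v z *\<^sub>R outer2 (z - a)) *v x) \<partial>Q) = x \<bullet> ((\<integral>z. v z *\<^sub>R outer2 (z - a) \<partial>Q) *v x)"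
    by (rule integral_bounded_linear[OF bounded_linear_quadratic_form
          integrable_weighted_outer2(1)[OF assms order_refl]])
  then show ?thesis
    by (simp add: scaleR_matrix_vector_assoc[symmetric] inner_outer2_mult inner_diff_right)
qed

text \<open>The weighted sum inside \<open>outer2\<close> has norm at most
  \<open>S * (c + c)\<close>, so after squaring, one factor \<open>S\<close> cancels against the
  denominator and the bound is linear in \<open>S\<close>. No lower bound on the weights enters the
  estimate.\<close>

lemma
  shows integrable_G: "integrable (Pi\<^sub>M J (\<lambda>_. Q)) G"
    and norm_integral_G_le: "norm (\<integral>x. G x \<partial>Pi\<^sub>M J (\<lambda>_. Q)) \<le> (real m + 1) * (exp (norm \<beta> * c) * (c + c)\<^sup>2)"
proof -
  interpret N: prob_space "Pi\<^sub>M J (\<lambda>_. Q)"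
    by (intro prob_space_PiM) unfold_locales
  have "AE x in Pi\<^sub>M J (\<lambda>_. Q). norm (G x) \<le> (real m + 1) * (exp (norm \<beta> * c) * (c + c)\<^sup>2)"
    using AE_PiM_finite[OF finite_atLeastAtMost Q.prob_space_axioms AE_Q_norm]
      AE_PiM_finite[OF finite_atLeastAtMost Q.prob_space_axioms AE_Q_\<theta>]
  proof eventually_elim
    case (elim x)
    define S where "S = (\<Sum>j\<in>J. \<theta> (x j))"
    have S: "0 < S" unfolding S_def by (intro sum_pos \<theta>_pos) auto
    have "S \<le> (\<Sum>j\<in>J. exp (norm \<beta> * c))" unfolding S_def by (intro sum_mono) (use elim in blast)
    then have S_le: "S \<le> (real m + 1) * exp (norm \<beta> * c)" by (simp add: algebra_simps)
    have "norm (\<Sum>j\<in>J. \<theta> (x j) *\<^sub>R (x j - \<mu>)) \<le> (\<Sum>j\<in>J. norm (\<theta> (x j) *\<^sub>R (x j - \<mu>)))"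
      by (rule norm_sum)
    also have "\<dots> \<le> (\<Sum>j\<in>J. \<theta> (x j) * (c + c))"
    proof (rule sum_mono)
      fix j assume "j \<in> J"
      then have "norm (x j) \<le> c" using elim by blast
      then have "norm (x j - \<mu>) \<le> c + c" using norm_triangle_ineq4[of "x j" \<mu>] norm_\<mu>_le by linarith
      then show "norm (\<theta> (x j) *\<^sub>R (x j - \<mu>)) \<le> \<theta> (x j) * (c + c)"
        by (simp add: abs_of_pos[OF \<theta>_pos] \<theta>_pos)
    qed
    also have "\<dots> = S * (c + c)" by (simp only: S_def sum_distrib_right)
    finally have "norm (outer2 (\<Sum>j\<in>J. \<theta> (x j) *\<^sub>R (x j - \<mu>))) \<le> (S * (c + c))\<^sup>2"
      unfolding norm_outer2 by (rule power_mono) simp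
    then have "norm (G x) \<le> (S * (c + c))\<^sup>2 / S"
      unfolding G_def S_def[symmetric] using S by (simp add: divide_inverse mult.commute)
    also have "\<dots> = S * (c + c)\<^sup>2" using S by (simp add: power2_eq_square)
    also have "\<dots> \<le> ((real m + 1) * exp (norm \<beta> * c)) * (c + c)\<^sup>2"
      by (intro mult_right_mono S_le) simp
    finally show ?case by (simp only: mult.assoc)
  qed
  then show "integrable (Pi\<^sub>M J (\<lambda>_. Q)) G"
    "norm (\<integral>x. G x \<partial>Pi\<^sub>M J (\<lambda>_. Q)) \<le> (real m + 1) * (exp (norm \<beta> * c) * (c + c)\<^sup>2)"
    by (rule N.integrable_AE_norm_bounded[rotated] N.norm_expectation_le[rotated];
        measurable)+
qed

lemma norm_cox_information_le: "norm Cox \<le> exp (norm \<beta> * c) * (c + c)\<^sup>2"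
proof -
  have "norm (\<integral>z. \<theta> z *\<^sub>R outer2 (z - \<mu>) \<partial>Q) \<le> exp (norm \<beta> * c) * (c + c)\<^sup>2"
    by (rule integrable_weighted_outer2) (auto simp: less_imp_le \<theta>_pos norm_\<mu>_le)
  then have "prob R * norm (\<integral>z. \<theta> z *\<^sub>R outer2 (z - \<mu>) \<partial>Q) \<le> 1 * (exp (norm \<beta> * c) * (c + c)\<^sup>2)"
    by (intro mult_mono) auto
  then show ?thesis unfolding cox_information_eq by simp
qed

lemma norm_sampling_loss_le: "norm Loss \<le> (real m + 1) * (exp (norm \<beta> * c) * (c + c)\<^sup>2)"
proof -
  have "prob R * norm (\<integral>x. G x \<partial>Pi\<^sub>M J (\<lambda>_. Q)) \<le> 1 * ((real m + 1) * (exp (norm \<beta> * c) * (c + c)\<^sup>2))"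
    by (rule mult_mono[OF _ norm_integral_G_le]) auto
  then show ?thesis unfolding sampling_loss_eq by simp
qed

lemma quadratic_form_sampling_loss:
  "x \<bullet> (Loss *v x) = prob R * (\<integral>y. (\<Sum>j\<in>J. \<theta> (y j) * (x \<bullet> y j - x \<bullet> \<mu>))\<^sup>2 / (\<Sum>j\<in>J. \<theta> (y j)) \<partial>Pi\<^sub>M J (\<lambda>_. Q))"
proof -
  have "(\<integral>y. x \<bullet> (G y *v x) \<partial>Pi\<^sub>M J (\<lambda>_. Q)) = x \<bullet> ((\<integral>y. G y \<partial>Pi\<^sub>M J (\<lambda>_. Q)) *v x)"
    by (rule integral_bounded_linear[OF bounded_linear_quadratic_form integrable_G])
  moreover have "x \<bullet> (G y *v x) = (\<Sum>j\<in>J. \<theta> (y j) * (x \<bullet> y j - x \<bullet> \<mu>))\<^sup>2 / (\<Sum>j\<in>J. \<theta> (y j))" for y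
    unfolding G_def scaleR_matrix_vector_assoc[symmetric] inner_scaleR_right inner_outer2_mult
      inner_sum_right inner_diff_right by (simp only: divide_inverse mult.commute)
  ultimately show ?thesis
    unfolding sampling_loss_eq scaleR_matrix_vector_assoc[symmetric] inner_scaleR_right by simp
qed

lemma quadratic_form_cox_information:
  "x \<bullet> (Cox *v x) = prob R * (\<integral>z. \<theta> z * (x \<bullet> z - x \<bullet> \<mu>)\<^sup>2 \<partial>Q)"
  unfolding cox_information_eq
  by (rule quadratic_form_weighted_outer2) (auto simp: less_imp_le \<theta>_pos)

lemma quadratic_form_weighted_information:
  "x \<bullet> (Weighted *v x) = prob R * (\<integral>z. w z * \<theta> z * (x \<bullet> z - x \<bullet> g)\<^sup>2 \<partial>Q)"
  unfolding weighted_information_eq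
  by (rule quadratic_form_weighted_outer2)
    (auto simp: less_imp_le \<theta>_pos w_bounds intro!: mult_left_le_one_le)

text \<open>The substance is the balance condition; it is the definition of \<open>g\<close> as a
  weighted mean, with the constant \<open>m * b\<close> divided out.\<close>

lemma case_control_sample:
  "case_control_sample Q J \<theta> (\<lambda>z. x \<bullet> z) (exp (- (norm \<beta> * c))) (exp (norm \<beta> * c)) (norm x * c) (x \<bullet> g) m"
proof
  show "AE z in Q. \<bar>x \<bullet> z\<bar> \<le> norm x * c"
    using AE_Q_norm
  proof eventually_elim
    case (elim z)
    have "\<bar>x \<bullet> z\<bar> \<le> norm x * norm z" by (rule Cauchy_Schwarz_ineq2)
    also have "\<dots> \<le> norm x * c" using elim by (intro mult_left_mono) auto
    finally show ?case .
  qed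
  define b where "b = (\<integral>z. \<theta> z \<partial>Q)"
  have mb: "0 < real m * b" using expectation_\<theta>_pos m_pos by (simp add: b_def)
  have v: "0 < w z * \<theta> z \<and> w z * \<theta> z \<le> \<theta> z" for z
    using \<theta>_pos w_bounds by (auto intro!: mult_left_le_one_le simp: less_imp_le)
  have i: "integrable Q (\<lambda>z. w z * \<theta> z)"
    by (rule Bochner_Integration.integrable_bound[OF integrable_\<theta>])
      (use v in \<open>auto simp: abs_of_pos \<theta>_pos less_imp_le\<close>)
  have iz: "integrable Q (\<lambda>z. (w z * \<theta> z) *\<^sub>R z)"
  proof (rule Q.integrable_AE_norm_bounded)
    show "AE z in Q. norm ((w z * \<theta> z) *\<^sub>R z) \<le> exp (norm \<beta> * c) * c"
      using AE_Q_norm AE_Q_\<theta>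
    proof eventually_elim
      case (elim z)
      have "\<bar>w z * \<theta> z\<bar> \<le> exp (norm \<beta> * c)" using v[of z] elim by linarith
      then show ?case using elim unfolding norm_scaleR real_norm_def by (intro mult_mono) auto
    qed
  qed measurable
  \<comment> \<open>Were this denominator zero, the quotient \<open>g\<close> would be 0 by
    convention and not a weighted mean.\<close>
  have "(\<integral>z. w z * \<theta> z \<partial>Q) \<noteq> 0"
  proof
    assume "(\<integral>z. w z * \<theta> z \<partial>Q) = 0"
    then have "AE z in Q. w z * \<theta> z = 0"
      using integral_nonneg_eq_0_iff_AE[OF i] v by (auto simp: less_imp_le)
    then have "AE z in Q. False" by eventually_elim (use v in \<open>simp add: less_le\<close>)
    then show False by simp
  qed
  then have "x \<bullet> g * (\<integral>z. w z * \<theta> z \<partial>Q) = x \<bullet> (\<integral>z. (w z * \<theta> z) *\<^sub>R z \<partial>Q)"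
    by (simp add: g_eq)
  also have "\<dots> = (\<integral>z. w z * \<theta> z * (x \<bullet> z) \<partial>Q)"
    using integral_inner_right[of x Q "\<lambda>z. (w z * \<theta> z) *\<^sub>R z"] iz by simp
  finally have "(\<integral>z. w z * \<theta> z * (x \<bullet> z) - w z * \<theta> z * (x \<bullet> g) \<partial>Q) = 0"
    using i integrable_inner_right[of x Q "\<lambda>z. (w z * \<theta> z) *\<^sub>R z"] iz
    by (subst Bochner_Integration.integral_diff) (simp_all add: mult.commute)
  also have "(\<lambda>z. w z * \<theta> z * (x \<bullet> z) - w z * \<theta> z * (x \<bullet> g)) =
      (\<lambda>z. real m * b * (\<theta> z * (x \<bullet> z - x \<bullet> g) / (\<theta> z + real m * b)))"
    unfolding w_def b_def[symmetric] by (simp add: fun_eq_iff algebra_simps diff_divide_distrib)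
  also have "integral\<^sup>L Q \<dots> = real m * b * (\<integral>z. \<theta> z * (x \<bullet> z - x \<bullet> g) / (\<theta> z + real m * b) \<partial>Q)"
    by (rule integral_mult_right_zero)
  finally show "(\<integral>z. \<theta> z * (x \<bullet> z - x \<bullet> g) / (\<theta> z + real m * (\<integral>z. \<theta> z \<partial>Q)) \<partial>Q) = 0"
    using mb by (auto simp: b_def)
qed (use AE_Q_\<theta> m_pos in auto)

lemma information_loss:
  shows "x \<bullet> (Cox *v x) - x \<bullet> (Loss *v x) / (real m + 1) \<le> x \<bullet> (Weighted *v x)"
    (is ?le)
    and "\<beta> \<bullet> (Cox *v \<beta>) - \<beta> \<bullet> (Loss *v \<beta>) / (real m + 1) = \<beta> \<bullet> (Weighted *v \<beta>)
      \<Longrightarrow> \<beta> \<bullet> (Weighted *v \<beta>) = 0" (is "?eq \<Longrightarrow> ?zero")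
    and "\<beta> = 0 \<Longrightarrow>
      x \<bullet> (Cox *v x) - x \<bullet> (Loss *v x) / (real m + 1) = x \<bullet> (Weighted *v x)"
    (is "_ \<Longrightarrow> ?null")
proof -
  define gap where "gap x = (\<integral>y. (case_control_sample.D Q J \<theta> (\<lambda>z. x \<bullet> z) (x \<bullet> g) m y)\<^sup>2 /
    case_control_sample.S J \<theta> y \<partial>Pi\<^sub>M J (\<lambda>_. Q))" for x
  have loss: "x \<bullet> (Cox *v x) - x \<bullet> (Loss *v x) / (real m + 1) + prob R * gap x / (real m + 1)
      = x \<bullet> (Weighted *v x)"
    and gap: "0 \<le> gap x" and zero: "\<beta> = 0 \<Longrightarrow> gap x = 0"
    and zeroW: "gap \<beta> = 0 \<Longrightarrow> \<beta> \<bullet> (Weighted *v \<beta>) = 0" for x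
  proof -
    interpret cc: case_control_sample Q J \<theta> "\<lambda>z. x \<bullet> z" "exp (- (norm \<beta> * c))" "exp (norm \<beta> * c)"
      "norm x * c" "x \<bullet> g" m by (rule case_control_sample)
    \<comment> \<open>A second instance: the identity concerns an arbitrary direction
      \<open>x\<close>, whereas the degenerate case concerns \<open>\<beta>\<close>, where
      \<open>u = ln \<theta>\<close>.\<close>
    interpret cb: case_control_sample Q J \<theta> "\<lambda>z. \<beta> \<bullet> z" "exp (- (norm \<beta> * c))" "exp (norm \<beta> * c)"
      "norm \<beta> * c" "\<beta> \<bullet> g" m by (rule case_control_sample)
    have W: "x \<bullet> (Weighted *v x) = prob R * cc.W"
      "\<beta> \<bullet> (Weighted *v \<beta>) = prob R * cb.W"
      unfolding quadratic_form_weighted_information cc.W_def cc.b_def cb.W_def cb.b_def w_def by simp_all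
    have N: "cc.N = Pi\<^sub>M J (\<lambda>_. Q)" "cb.N = Pi\<^sub>M J (\<lambda>_. Q)" unfolding cc.N_def cb.N_def by simp_all
    have arith: "p * X - p * Yy / n + p * Gg / n = p * V" if "X - Yy / n + Gg / n = V" for p X Yy Gg n V :: real
      unfolding that[symmetric] by (simp add: algebra_simps)
    show "x \<bullet> (Cox *v x) - x \<bullet> (Loss *v x) / (real m + 1) + prob R * gap x / (real m + 1)
      = x \<bullet> (Weighted *v x)"
      unfolding W quadratic_form_cox_information quadratic_form_sampling_loss gap_def
      by (rule arith) (use cc.information_gap(2)[of "x \<bullet> \<mu>"] in \<open>simp only: N cc.S_def\<close>)
    show "0 \<le> gap x" using cc.gap_nonneg unfolding gap_def N .
    show "gap x = 0" if "\<beta> = 0"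
    proof -
      have "\<theta> z = 1" for z unfolding \<theta>_def by (simp add: that)
      then have "AE z in Q. \<theta> z = 1" by simp
      then show ?thesis using cc.gap_eq_0_if_const[of 1] unfolding gap_def N by blast
    qed
    show "\<beta> \<bullet> (Weighted *v \<beta>) = 0" if "gap \<beta> = 0"
      using cb.gap_eq_0_imp_W_eq_0 that W unfolding gap_def N by (simp add: \<theta>_def)
  qed
  have "0 \<le> prob R * gap x / (real m + 1)" using gap by simp
  then show ?le using loss[of x] by linarith
  show ?null if "\<beta> = 0" using loss[of x] zero[OF that] by simp
  assume ?eq
  then have "prob R * gap \<beta> / (real m + 1) = 0" using loss[of \<beta>] by linarith
  then have "gap \<beta> = 0" using prob_R_pos by (simp add: add_eq_0_iff)
  then show ?zero by (rule zeroW)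
qed

end

section \<open>Integration over time\<close>

text \<open>\<open>\<lceil>s\<rceil> - 1\<close> is the largest integer strictly below
  \<open>s\<close>, so the approach stays strictly left of \<open>t\<close> even when
  \<open>t\<close> is a grid point; the floor would not achieve this.\<close>

lemma filterlim_grid_at_left:
  fixes t :: real
  shows "filterlim (\<lambda>n. (of_int \<lceil>t * (real n + 1)\<rceil> - 1) / (real n + 1)) (at_left t) sequentially"
  unfolding filterlim_at
proof (rule conjI, rule always_eventually, rule allI)
  fix n
  have "of_int \<lceil>t * (real n + 1)\<rceil> - 1 < t * (real n + 1)" by linarith
  then show "(of_int \<lceil>t * (real n + 1)\<rceil> - 1) / (real n + 1) \<in> {..<t} \<and>
      (of_int \<lceil>t * (real n + 1)\<rceil> - 1) / (real n + 1) \<noteq> t"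
    by (simp add: divide_simps mult.commute)
next
  show "(\<lambda>n. (of_int \<lceil>t * (real n + 1)\<rceil> - 1) / (real n + 1)) \<longlonglongrightarrow> t"
  proof (rule tendsto_sandwich[OF always_eventually always_eventually])
    show "\<forall>n. t - 1 / (real n + 1) \<le> (of_int \<lceil>t * (real n + 1)\<rceil> - 1) / (real n + 1)"
    proof
      fix n
      have "t * (real n + 1) - 1 \<le> of_int \<lceil>t * (real n + 1)\<rceil> - 1" by linarith
      then have "(t * (real n + 1) - 1) / (real n + 1) \<le> (of_int \<lceil>t * (real n + 1)\<rceil> - 1) / (real n + 1)"
        by (intro divide_right_mono) auto
      then show "t - 1 / (real n + 1) \<le> (of_int \<lceil>t * (real n + 1)\<rceil> - 1) / (real n + 1)"
        by (simp add: diff_divide_distrib)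
    qed
    show "\<forall>n. (of_int \<lceil>t * (real n + 1)\<rceil> - 1) / (real n + 1) \<le> t"
    proof
      fix n
      have "of_int \<lceil>t * (real n + 1)\<rceil> - 1 \<le> t * (real n + 1)" by linarith
      then show "(of_int \<lceil>t * (real n + 1)\<rceil> - 1) / (real n + 1) \<le> t"
        by (simp add: divide_simps mult.commute)
    qed
    show "(\<lambda>n. t - 1 / (real n + 1)) \<longlonglongrightarrow> t"
      using tendsto_diff[OF tendsto_const LIMSEQ_inverse_real_of_nat, of t]
      by (simp add: inverse_eq_divide add.commute)
  qed simp
qed

text \<open>
  Clipping the time at \<open>0\<close> discards the arbitrary values at negative times; for \<open>t > 0\<close> the value is
  the limit along grid points to the left of \<open>t\<close>, by left continuity.
\<close>
lemma jointly_measurable_covariate_process: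
  assumes "covariate_process M Z"
  shows "(\<lambda>(t, \<omega>). Z (max 0 t) \<omega>) \<in> borel_measurable (borel \<Otimes>\<^sub>M M)"
proof (rule borel_measurable_LIMSEQ_metric)
  define U where "U n = (\<lambda>p. Z (max 0 ((of_int \<lceil>fst p * (real n + 1)\<rceil> - 1) / (real n + 1))) (snd p))" for n
  show "U n \<in> borel_measurable (borel \<Otimes>\<^sub>M M)" for n
    unfolding U_def
  \<comment> \<open>For fixed \<open>n\<close> the ceiling takes countably many values, and on each
    of them \<open>U n\<close> is a single random variable of the process.\<close>
  proof (rule measurable_compose_countable[where g="\<lambda>p. \<lceil>fst p * (real n + 1)\<rceil>"])
    fix i :: int
    have "Z (max 0 ((of_int i - 1) / (real n + 1))) \<in> borel_measurable M"
      using assms by (simp add: covariate_process_def)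
    then show "(\<lambda>p. Z (max 0 ((of_int i - 1) / (real n + 1))) (snd p)) \<in> borel_measurable (borel \<Otimes>\<^sub>M M)"
      by (rule measurable_compose[OF measurable_snd])
  qed measurable
  fix p assume "p \<in> space (borel \<Otimes>\<^sub>M M :: (real \<times> 'a) measure)"
  then obtain t \<omega> where p: "p = (t, \<omega>)" and \<omega>: "\<omega> \<in> space M"
    by (auto simp: space_pair_measure)
  show "(\<lambda>n. U n p) \<longlonglongrightarrow> (case p of (t, \<omega>) \<Rightarrow> Z (max 0 t) \<omega>)"
  proof (cases "0 < t")
    case True
    have "((\<lambda>t. Z t \<omega>) \<longlongrightarrow> Z t \<omega>) (at_left t)"
      using assms \<omega> True by (auto simp: covariate_process_def left_cont_right_lim_def continuous_within)
    from filterlim_compose[OF this filterlim_grid_at_left]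
    have "(\<lambda>n. Z ((of_int \<lceil>t * (real n + 1)\<rceil> - 1) / (real n + 1)) \<omega>) \<longlonglongrightarrow> Z t \<omega>" .
    moreover have "0 \<le> (of_int \<lceil>t * (real n + 1)\<rceil> - 1) / (real n + 1)" for n
    proof -
      have "0 < t * (real n + 1)" using True by simp
      then have "1 \<le> \<lceil>t * (real n + 1)\<rceil>" by linarith
      then show ?thesis by simp
    qed
    ultimately show ?thesis using True by (simp add: p U_def max_absorb2)
  next
    case False
    have "(of_int \<lceil>t * (real n + 1)\<rceil> - 1) / (real n + 1) \<le> 0" for n
    proof -
      have "t * (real n + 1) \<le> 0" using False by (intro mult_nonpos_nonneg) auto
      then have "\<lceil>t * (real n + 1)\<rceil> \<le> 0" by linarith
      then show ?thesis by (intro divide_nonpos_pos) auto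
    qed
    then show ?thesis using False by (simp add: p U_def max_absorb1)
  qed
qed

lemma (in prob_space)
  fixes Z :: "real \<Rightarrow> 'a \<Rightarrow> real ^ 'd"
  assumes Z[measurable]: "(\<lambda>(t, \<omega>). Z t \<omega>) \<in> borel_measurable (borel \<Otimes>\<^sub>M M)"
    and Y[measurable]: "Y \<in> borel_measurable M"
  shows measurable_mu_fun: "mu_fun M Y Z \<beta> \<in> borel_measurable borel"
    and measurable_cox_information: "cox_information M Y Z \<beta> \<in> borel_measurable borel"
proof -
  show [measurable]: "mu_fun M Y Z \<beta> \<in> borel_measurable borel"
    unfolding mu_fun_def[abs_def] at_risk_def by measurable
  show "cox_information M Y Z \<beta> \<in> borel_measurable borel"
    unfolding cox_information_def[abs_def] at_risk_def by measurable
qed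

text \<open>The conditioning event moves with \<open>t\<close>. Writing probabilities and
  conditional means as integrals over \<open>M\<close> of jointly measurable functions of
  \<open>(t, \<omega>)\<close> turns the claim into measurability of parameter integrals.\<close>

lemma (in prob_space) measurable_sampling_loss:
  fixes Z :: "real \<Rightarrow> 'a \<Rightarrow> real ^ 'd"
  assumes Z: "(\<lambda>(t, \<omega>). Z t \<omega>) \<in> borel_measurable (borel \<Otimes>\<^sub>M M)"
    and Y[measurable]: "Y \<in> borel_measurable M"
    and Zs: "\<And>j. j \<in> {1..m+1} \<Longrightarrow> (\<lambda>(t, \<omega>). Zs j t \<omega>) \<in> borel_measurable (borel \<Otimes>\<^sub>M M)"
    and Ys: "\<And>j. j \<in> {1..m+1} \<Longrightarrow> Ys j \<in> borel_measurable M"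
  shows "sampling_loss M Y Z Ys Zs \<beta> m \<in> borel_measurable borel"
proof -
  note [measurable] = measurable_mu_fun[OF Z Y]
  define J where "J = {1..m+1}"
  have mZs[measurable]: "(\<lambda>p. Zs j (fst p) (snd p)) \<in> borel_measurable (borel \<Otimes>\<^sub>M M)" if "j \<in> J" for j
    using Zs that by (simp add: J_def case_prod_beta')
  have mYs[measurable]: "Ys j \<in> borel_measurable M" if "j \<in> J" for j
    using Ys that by (simp add: J_def)
  define E where "E p \<longleftrightarrow> (\<forall>j\<in>J. fst p \<le> Ys j (snd p))" for p
  have mE[measurable]: "Measurable.pred (borel \<Otimes>\<^sub>M M) E"
    unfolding E_def[abs_def]
  proof (rule pred_intros_finite)
    show "finite J" by (simp add: J_def)
    fix j assume "j \<in> J"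
    note [measurable] = mYs[OF this]
    show "Measurable.pred (borel \<Otimes>\<^sub>M M) (\<lambda>p. fst p \<le> Ys j (snd p))" by measurable
  qed
  have prob_eq: "prob {\<omega>\<in>space M. P \<omega>} = (\<integral>\<omega>. indicator {\<omega>. P \<omega>} \<omega> \<partial>M)" for P
  proof -
    have "(\<integral>\<omega>. indicator {\<omega>. P \<omega>} \<omega> \<partial>M) = measure M ({\<omega>. P \<omega>} \<inter> space M)"
      by simp
    also have "{\<omega>. P \<omega>} \<inter> space M = {\<omega>\<in>space M. P \<omega>}" by auto
    finally show ?thesis by simp
  qed
  define V where "V p = outer2 (\<Sum>j\<in>J. exp (\<beta> \<bullet> Zs j (fst p) (snd p)) *\<^sub>R (Zs j (fst p) (snd p) - mu_fun M Y Z \<beta> (fst p))) /\<^sub>R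
        (\<Sum>j\<in>J. exp (\<beta> \<bullet> Zs j (fst p) (snd p)))" for p
  have [measurable]: "V \<in> borel_measurable (borel \<Otimes>\<^sub>M M)"
    unfolding V_def[abs_def] by measurable
  have "sampling_loss M Y Z Ys Zs \<beta> m = (\<lambda>t. (\<integral>\<omega>. indicator {\<omega>. t \<le> Y \<omega>} \<omega> \<partial>M) *\<^sub>R
     ((\<integral>\<omega>. indicator {\<omega>. E (t, \<omega>)} \<omega> *\<^sub>R V (t, \<omega>) \<partial>M) /\<^sub>R (\<integral>\<omega>. indicator {\<omega>. E (t, \<omega>)} \<omega> \<partial>M)))"
    unfolding sampling_loss_def[abs_def] cond_expect_def set_lebesgue_integral_def prob_eq[symmetric]
      J_def[symmetric] E_def V_def fst_conv snd_conv
    by (intro ext arg_cong2[where f=scaleR] refl Bochner_Integration.integral_cong)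
      (auto simp: indicator_def)
  also have "\<dots> \<in> borel_measurable borel"
    unfolding indicator_def of_bool_def mem_Collect_eq by measurable
  finally show ?thesis .
qed

text \<open>Joint measurability is available for the clipped process; at nonnegative times it yields
  the same matrices.\<close>

lemma information_time_max:
  assumes "0 \<le> t"
  shows "cox_information M Y (\<lambda>t. Z (max 0 t)) \<beta> t = cox_information M Y Z \<beta> t"
    "sampling_loss M Y (\<lambda>t. Z (max 0 t)) Ys (\<lambda>j t. Zs j (max 0 t)) \<beta> m t = sampling_loss M Y Z Ys Zs \<beta> m t"
  using assms by (simp_all add: cox_information_def sampling_loss_def mu_fun_def max_absorb2)


section \<open>From i.i.d. copies to product probabilities of rectangles\<close>

lemma (in prob_space) random_variable_observation:
  assumes "T \<in> borel_measurable M" "C \<in> borel_measurable M" "covariate_process M Z"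
  shows "observation T C Z \<in> measurable M observation_space"
proof -
  have "path Z \<in> measurable M (Pi\<^sub>M {0..} (\<lambda>_. borel))"
    unfolding path_def[abs_def] using assms(3)
    by (intro measurable_restrict) (simp add: covariate_process_def)
  then show ?thesis
    unfolding observation_def[abs_def] observation_space_def using assms(1,2)
    by (intro measurable_Pair)
qed

lemma (in prob_space) iid_copies_random_variable:
  assumes "iid_copies M T C Z Ts Cs Zs" "1 \<le> j"
  shows "observation (Ts j) (Cs j) (Zs j) \<in> measurable M observation_space"
    and "follow_up (Ts j) (Cs j) \<in> borel_measurable M"
proof -
  show o: "observation (Ts j) (Cs j) (Zs j) \<in> measurable M observation_space"
    using assms unfolding iid_copies_def indep_vars_def2 by simp
  have "(\<lambda>\<omega>. min (fst (observation (Ts j) (Cs j) (Zs j) \<omega>))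
      (fst (snd (observation (Ts j) (Cs j) (Zs j) \<omega>)))) \<in> borel_measurable M"
    using o unfolding observation_space_def
    by (intro borel_measurable_min measurable_compose[OF o[unfolded observation_space_def]]) measurable
  then show "follow_up (Ts j) (Cs j) \<in> borel_measurable M"
    by (simp add: observation_def follow_up_def[abs_def])
qed

text \<open>Each event is the preimage under one observation of a cylinder set that looks only at
  the two times and at the path at \<open>t\<close>. The condition \<open>0 \<le> t\<close> makes
  that coordinate exist, since \<open>path\<close> is restricted to nonnegative times. Independence
  and equality of laws then finish.\<close>

lemma (in prob_space) iid_copies_rectangles:
  assumes iid: "iid_copies M T C Z Ts Cs Zs" and t: "0 \<le> t" and J: "finite J" "J \<noteq> {}" "J \<subseteq> {1..}"
    and model: "T \<in> borel_measurable M" "C \<in> borel_measurable M" "covariate_process M Z"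
    and A: "\<And>j. j \<in> J \<Longrightarrow> A j \<in> sets borel"
  shows "prob {\<omega>\<in>space M. \<forall>j\<in>J. t \<le> follow_up (Ts j) (Cs j) \<omega> \<and> Zs j t \<omega> \<in> A j} =
    (\<Prod>j\<in>J. prob {\<omega>\<in>space M. t \<le> follow_up T C \<omega> \<and> Z t \<omega> \<in> A j})"
proof -
  define X where "X j = observation (Ts j) (Cs j) (Zs j)" for j
  define B where "B j = {p\<in>space observation_space. t \<le> min (fst p) (fst (snd p)) \<and> snd (snd p) t \<in> A j}" for j
  have B: "B j \<in> sets observation_space" if "j \<in> J" for j
  proof -
    have [measurable]: "A j \<in> sets borel" using A[OF that] .
    have [measurable]: "(\<lambda>z. z t) \<in> measurable (Pi\<^sub>M {0..} (\<lambda>_. borel :: (real^'b) measure)) borel"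
      using t by (intro measurable_component_singleton) simp
    show ?thesis unfolding B_def observation_space_def by measurable
  qed
  have vimage: "observation T' C' Z' -` B j \<inter> space M = {\<omega>\<in>space M. t \<le> follow_up T' C' \<omega> \<and> Z' t \<omega> \<in> A j}"
    if "observation T' C' Z' \<in> measurable M observation_space" for T' C' Z' j
    using measurable_space[OF that] t by (auto simp: B_def observation_def follow_up_def path_def)
  have X: "X j \<in> measurable M observation_space" if "j \<in> J" for j
    unfolding X_def using iid_copies_random_variable(1)[OF iid] J(3) that by auto
  have "prob (X j -` B j \<inter> space M) = prob {\<omega>\<in>space M. t \<le> follow_up T C \<omega> \<and> Z t \<omega> \<in> A j}" if j: "j \<in> J" for j
  proof -
    have "prob (X j -` B j \<inter> space M) = measure (distr M observation_space (X j)) (B j)"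
      using X[OF j] B[OF j] by (simp add: measure_distr)
    also have "distr M observation_space (X j) = distr M observation_space (observation T C Z)"
      using iid j J(3) unfolding iid_copies_def X_def by auto
    also have "measure \<dots> (B j) = prob (observation T C Z -` B j \<inter> space M)"
      using random_variable_observation[OF model] B[OF j] by (simp add: measure_distr)
    finally show ?thesis using vimage[OF random_variable_observation[OF model]] by simp
  qed
  moreover have "prob (\<Inter>j\<in>J. X j -` B j \<inter> space M) = (\<Prod>j\<in>J. prob (X j -` B j \<inter> space M))"
    using iid J B unfolding iid_copies_def X_def by (intro indep_varsD) auto
  moreover have "(\<Inter>j\<in>J. X j -` B j \<inter> space M) =
      {\<omega>\<in>space M. \<forall>j\<in>J. t \<le> follow_up (Ts j) (Cs j) \<omega> \<and> Zs j t \<omega> \<in> A j}"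
    using J(2) vimage[OF X[unfolded X_def]] unfolding X_def by auto
  ultimately show ?thesis by simp
qed

lemma norm_le_norm1: "norm v \<le> norm1 v"
  unfolding norm1_def by (rule norm_le_l1_cart)

text \<open>\<open>F'\<close> is a measurable version of \<open>F\<close> on \<open>I\<close>; in
  the application it comes from the clipped process. Likewise \<open>h0\<close> is measurable only
  on \<open>{0..}\<close> and is cut off there.\<close>

lemma set_integrable_bounded_intensity:
  fixes F :: "real \<Rightarrow> 'b::{banach, second_countable_topology}"
  assumes h0: "set_borel_measurable borel {0..} h0" and I: "I \<in> sets borel" "I \<subseteq> {0..}" "emeasure lborel I < \<infinity>"
    and hb: "\<And>t. t \<in> I \<Longrightarrow> 0 \<le> h0 t \<and> h0 t \<le> b"
    and F: "F' \<in> borel_measurable borel" "\<And>t. t \<in> I \<Longrightarrow> F' t = F t" "\<And>t. t \<in> I \<Longrightarrow> norm (F t) \<le> B"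
  shows "set_integrable lborel I (\<lambda>t. h0 t *\<^sub>R F t)"
proof -
  define k where "k t = indicator {0..} t * h0 t" for t
  have [measurable]: "k \<in> borel_measurable borel"
    using h0 unfolding set_borel_measurable_def k_def[abs_def] by simp
  note [measurable] = F(1)
  have "integrable lborel (\<lambda>t. indicator I t *\<^sub>R (k t *\<^sub>R F' t))"
  proof (rule integrableI_bounded_set_indicator)
    show "AE t in lborel. t \<in> I \<longrightarrow> norm (k t *\<^sub>R F' t) \<le> b * B"
    proof (intro AE_I2 impI)
      fix t assume t: "t \<in> I"
      then have "\<bar>h0 t\<bar> * norm (F t) \<le> b * B"
        using hb[OF t] F(3)[OF t] by (intro mult_mono) auto
      then show "norm (k t *\<^sub>R F' t) \<le> b * B" using t I(2) F(2)[OF t] by (auto simp: k_def)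
    qed
  qed (use I in auto)
  moreover have "(\<lambda>t. indicator I t *\<^sub>R (k t *\<^sub>R F' t)) = (\<lambda>t. indicator I t *\<^sub>R (h0 t *\<^sub>R F t))"
    using I(2) F(2) by (auto simp: fun_eq_iff indicator_def k_def)
  ultimately show ?thesis unfolding set_integrable_def by simp
qed

lemma quadratic_form_set_integral:
  fixes F :: "real \<Rightarrow> real ^ 'n ^ 'n"
  assumes "set_integrable lborel I (\<lambda>t. h t *\<^sub>R F t)"
  shows "set_integrable lborel I (\<lambda>t. h t * (x \<bullet> (F t *v x)))"
    and "(LINT t:I|lborel. h t * (x \<bullet> (F t *v x))) = x \<bullet> ((LINT t:I|lborel. h t *\<^sub>R F t) *v x)"
proof -
  have e: "(\<lambda>t. x \<bullet> ((indicator I t *\<^sub>R h t *\<^sub>R F t) *v x)) = (\<lambda>t. indicator I t *\<^sub>R (h t * (x \<bullet> (F t *v x))))"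
    by (simp add: scaleR_matrix_vector_assoc[symmetric] mult.assoc)
  show "set_integrable lborel I (\<lambda>t. h t * (x \<bullet> (F t *v x)))"
    using integrable_bounded_linear[OF bounded_linear_quadratic_form[of x] assms[unfolded set_integrable_def]]
    unfolding e set_integrable_def .
  show "(LINT t:I|lborel. h t * (x \<bullet> (F t *v x))) = x \<bullet> ((LINT t:I|lborel. h t *\<^sub>R F t) *v x)"
    using integral_bounded_linear[OF bounded_linear_quadratic_form[of x] assms[unfolded set_integrable_def]]
    unfolding e set_lebesgue_integral_def .
qed

lemma pos_def_nonzero: "pos_def A \<Longrightarrow> A \<noteq> 0"
proof
  assume "pos_def A" "A = 0"
  then have "0 < (1 :: real^'a) \<bullet> (0 *v 1)" unfolding pos_def_def by auto
  then show False by simp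
qed

section \<open>Integrated comparison of the information matrices and of their inverses\<close>

theorem mainTheorem2:
  fixes M :: "'a measure"
    and T C :: "'a \<Rightarrow> real" and Z :: "real \<Rightarrow> 'a \<Rightarrow> real ^ 'd"
    and Ts Cs :: "nat \<Rightarrow> 'a \<Rightarrow> real" and Zs :: "nat \<Rightarrow> real \<Rightarrow> 'a \<Rightarrow> real ^ 'd"
    and \<beta> :: "real ^ 'd" and h0 :: "real \<Rightarrow> real" and c :: real and m :: nat
    and Y :: "'a \<Rightarrow> real" and Ys :: "nat \<Rightarrow> 'a \<Rightarrow> real"
    and \<tau> :: ereal and I :: "real set" and \<Sigma>\<^sub>P \<Sigma> :: "real ^ 'd ^ 'd"
  defines "Y \<equiv> follow_up T C"
    and "Ys \<equiv> \<lambda>i. follow_up (Ts i) (Cs i)"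
    and "\<tau> \<equiv> end_time M Y"
    and "I \<equiv> time_window M Y"
    and "\<Sigma>\<^sub>P \<equiv> Sigma_P M Y Z Ys Zs \<beta> h0 m"
    and "\<Sigma> \<equiv> Sigma_w M Y Z \<beta> h0 m"
  assumes "prob_space M"
    and "cox_model M T C Z \<beta> h0"
    and "iid_copies M T C Z Ts Cs Zs"
    and "1 \<le> m"
    and "0 < c"
    and i: "AE \<omega> in M. (SUP t\<in>I. ereal (norm1 (Z t \<omega>))) \<le> ereal c"
    and ii: "\<exists>a b. 0 < a \<and> (\<forall>t\<in>I. a \<le> h0 t \<and> h0 t \<le> b)" "cont_diff 2 I h0"
    and iii: "\<forall>t. 0 \<le> t \<and> t \<le> \<tau> \<longrightarrow> 0 < measure M {\<omega>\<in>space M. t \<le> ereal (Y \<omega>)}"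
    and iv: "pos_def \<Sigma>\<^sub>P" "pos_def \<Sigma>"
    and v: "\<forall>\<phi>\<in>C_inf (cball 0 c). cont_diff 2 I (\<lambda>t. LINT \<omega>|M. \<phi> (Z t \<omega>) * at_risk Y t \<omega>)"
    and vi: "\<forall>\<phi>\<in>C_inf (cball 0 c). converges_to_gaussian_process M I
      (\<lambda>n \<omega>. \<lambda>t\<in>I. (1 / sqrt (real n)) *
         (\<Sum>i=1..n. \<phi> (Zs i t \<omega>) * at_risk (Ys i) t \<omega> - (LINT \<omega>'|M. \<phi> (Z t \<omega>') * at_risk Y t \<omega>')))"
  shows "nonneg_def (matrix_inv \<Sigma>\<^sub>P - matrix_inv \<Sigma>) \<and>
    (matrix_inv \<Sigma>\<^sub>P = matrix_inv \<Sigma> \<longleftrightarrow> \<beta> = 0)"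
proof -
  interpret prob_space M by fact
  have T: "T \<in> borel_measurable M" and C: "C \<in> borel_measurable M" and Z: "covariate_process M Z"
    and h0: "set_borel_measurable borel {0..} h0"
    using \<open>cox_model M T C Z \<beta> h0\<close> by (auto simp: cox_model_def)
  note iid = \<open>iid_copies M T C Z Ts Cs Zs\<close>
  have Y: "Y \<in> borel_measurable M"
    unfolding Y_def follow_up_def[abs_def] using T C by measurable
  have Ys: "Ys j \<in> borel_measurable M" if "j \<in> {1..m+1}" for j
    unfolding Ys_def using iid_copies_random_variable(2)[OF iid] that by auto
  have Zs: "covariate_process M (Zs j)" if "j \<in> {1..m+1}" for j
    using iid that unfolding iid_copies_def by auto
  obtain a b where a: "0 < a" and ab: "\<And>t. t \<in> I \<Longrightarrow> a \<le> h0 t \<and> h0 t \<le> b"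
    using ii(1) by blast

  have I_def': "I = {t. 0 \<le> t \<and> ereal t \<le> \<tau>}"
    unfolding I_def time_window_def \<tau>_def ..
  \<comment> \<open>At an infinite end time, positivity of the risk probability would apply to the
    event that the real number \<open>Y \<omega>\<close> is at least infinity, which is
    empty.\<close>
  have "\<tau> \<noteq> \<infinity>" using iii[rule_format, of \<infinity>] by auto
  then have "\<exists>r. I \<subseteq> {0..r}"
    by (cases \<tau>) (auto simp: I_def' intro!: exI[of _ "real_of_ereal \<tau>"])
  then obtain r where r: "I \<subseteq> {0..r}" ..
  have I_sets: "I \<in> sets borel" unfolding I_def' by measurable
  have "emeasure lborel I \<le> emeasure lborel {0..r}" using r by (intro emeasure_mono) auto
  also have "\<dots> < \<infinity>" by (simp add: emeasure_lborel_Icc_eq)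
  finally have I_finite: "emeasure lborel I < \<infinity>" .
  have I_nonneg: "I \<subseteq> {0..}" by (auto simp: I_def')

  have rs: "risk_set M Y Z Ys Zs c m t" if t: "t \<in> I" for t
  proof
    have t0: "0 \<le> t" using t I_nonneg by auto
    show "random_variable borel (Z t)" using Z t0 by (simp add: covariate_process_def)
    show "random_variable borel (Zs j t)" if "j \<in> {1..m+1}" for j
      using Zs[OF that] t0 by (simp add: covariate_process_def)
    show "0 < prob {\<omega>\<in>space M. t \<le> Y \<omega>}"
      using iii[rule_format, of "ereal t"] t by (simp add: I_def')
    show "AE \<omega> in M. norm (Z t \<omega>) \<le> c"
      using i
    proof eventually_elim
      case (elim \<omega>)
      have "ereal (norm1 (Z t \<omega>)) \<le> ereal c" using elim t by (auto simp: SUP_le_iff)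
      then show ?case using norm_le_norm1[of "Z t \<omega>"] by simp
    qed
    show "prob {\<omega>\<in>space M. \<forall>j\<in>{1..m+1}. t \<le> Ys j \<omega> \<and> Zs j t \<omega> \<in> A j} =
        (\<Prod>j\<in>{1..m+1}. prob {\<omega>\<in>space M. t \<le> Y \<omega> \<and> Z t \<omega> \<in> A j})"
      if "\<And>j. j \<in> {1..m+1} \<Longrightarrow> A j \<in> sets borel" for A
      unfolding Y_def Ys_def
      by (rule iid_copies_rectangles[OF iid t0 _ _ _ T C Z that]) auto
  qed (use Y Ys \<open>1 \<le> m\<close> \<open>0 < c\<close> in auto)

  define Cx where "Cx = cox_information M Y Z \<beta>"
  define L where "L = sampling_loss M Y Z Ys Zs \<beta> m"
  define W where "W = weighted_information M Y Z \<beta> m"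
  define q where "q x A = x \<bullet> (A *v x)" for x and A :: "real^'d^'d"

  have hb: "0 \<le> h0 t \<and> h0 t \<le> b" if "t \<in> I" for t using ab[OF that] a by auto
  have mZ: "(\<lambda>(t, \<omega>). Z (max 0 t) \<omega>) \<in> borel_measurable (borel \<Otimes>\<^sub>M M)"
    by (rule jointly_measurable_covariate_process[OF Z])
  have mZs: "(\<lambda>(t, \<omega>). Zs j (max 0 t) \<omega>) \<in> borel_measurable (borel \<Otimes>\<^sub>M M)" if "j \<in> {1..m+1}" for j
    by (rule jointly_measurable_covariate_process[OF Zs[OF that]])
  have iC: "set_integrable lborel I (\<lambda>t. h0 t *\<^sub>R Cx t)" unfolding Cx_def
  proof (rule set_integrable_bounded_intensity[OF h0 I_sets I_nonneg I_finite hb measurable_cox_information[OF mZ Y, of \<beta>]])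
    show "cox_information M Y (\<lambda>t. Z (max 0 t)) \<beta> t = cox_information M Y Z \<beta> t" if "t \<in> I" for t
      using that I_nonneg by (intro information_time_max(1)[where Z=Z]) auto
    show "norm (cox_information M Y Z \<beta> t) \<le> exp (norm \<beta> * c) * (c + c)\<^sup>2" if "t \<in> I" for t
      by (rule risk_set.norm_cox_information_le[OF rs[OF that]])
  qed
  have iL: "set_integrable lborel I (\<lambda>t. h0 t *\<^sub>R L t)" unfolding L_def
  proof (rule set_integrable_bounded_intensity[OF h0 I_sets I_nonneg I_finite hb measurable_sampling_loss[OF mZ Y mZs Ys, where \<beta>=\<beta>]])
    show "sampling_loss M Y (\<lambda>t. Z (max 0 t)) Ys (\<lambda>j t. Zs j (max 0 t)) \<beta> m t = sampling_loss M Y Z Ys Zs \<beta> m t"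
      if "t \<in> I" for t
      using that I_nonneg by (intro information_time_max(2)[where Z=Z and Zs=Zs]) auto
    show "norm (sampling_loss M Y Z Ys Zs \<beta> m t) \<le> (real m + 1) * (exp (norm \<beta> * c) * (c + c)\<^sup>2)" if "t \<in> I" for t
      by (rule risk_set.norm_sampling_loss_le[OF rs[OF that]])
  qed
  have \<Sigma>: "\<Sigma> = (LINT t:I|lborel. h0 t *\<^sub>R W t)"
    unfolding \<Sigma>_def Sigma_w_def W_def weighted_information_def I_def ..
  \<comment> \<open>if it were not integrable, the integral would be the junk value \<open>0\<close>\<close>
  have iW: "set_integrable lborel I (\<lambda>t. h0 t *\<^sub>R W t)"
    using pos_def_nonzero[OF iv(2)] not_integrable_integral_eq
    unfolding \<Sigma> set_integrable_def set_lebesgue_integral_def by blast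
  have \<Sigma>\<^sub>P: "\<Sigma>\<^sub>P = (LINT t:I|lborel. h0 t *\<^sub>R Cx t) - (1 / (real m + 1)) *\<^sub>R (LINT t:I|lborel. h0 t *\<^sub>R L t)"
    unfolding \<Sigma>\<^sub>P_def Sigma_P_def Sigma_C_def Sigma_a_def Cx_def cox_information_def L_def
      sampling_loss_def I_def by (simp only: scaleR_scaleR mult.commute)

  \<comment> \<open>The shortfall of information at time \<open>t\<close> in direction
    \<open>x\<close>, before multiplication by the baseline hazard.\<close>
  define \<Delta> where "\<Delta> x t = q x (W t) - (q x (Cx t) - q x (L t) / (real m + 1))" for x t
  have iq: "set_integrable lborel I (\<lambda>t. h0 t * q x (Cx t))" "set_integrable lborel I (\<lambda>t. h0 t * q x (L t))"
    "set_integrable lborel I (\<lambda>t. h0 t * q x (W t))" for x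
    unfolding q_def by (intro quadratic_form_set_integral(1) iC iL iW)+
  have \<Delta>_eq: "(\<lambda>t. h0 t * \<Delta> x t) = (\<lambda>t. h0 t * q x (W t) - (h0 t * q x (Cx t) - h0 t * q x (L t) / (real m + 1)))" for x
    by (simp add: \<Delta>_def algebra_simps)
  have i\<Delta>: "set_integrable lborel I (\<lambda>t. h0 t * \<Delta> x t)" for x
    unfolding \<Delta>_eq using iq by (intro set_integral_diff set_integrable_divide) auto
  have q\<Sigma>: "q x \<Sigma> = (LINT t:I|lborel. h0 t * q x (W t))" for x
    unfolding \<Sigma> q_def quadratic_form_set_integral(2)[OF iW] ..
  have gap: "q x \<Sigma> - q x \<Sigma>\<^sub>P = (LINT t:I|lborel. h0 t * \<Delta> x t)" for x
  proof -
    have "q x \<Sigma>\<^sub>P = (LINT t:I|lborel. h0 t * q x (Cx t)) - (LINT t:I|lborel. h0 t * q x (L t)) / (real m + 1)"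
      unfolding \<Sigma>\<^sub>P q_def quadratic_form_set_integral(2)[OF iC] quadratic_form_set_integral(2)[OF iL]
      by (simp add: matrix_vector_mult_diff_rdistrib inner_diff_right scaleR_matrix_vector_assoc[symmetric])
    moreover have "(LINT t:I|lborel. h0 t * \<Delta> x t) = (LINT t:I|lborel. h0 t * q x (W t)) -
        ((LINT t:I|lborel. h0 t * q x (Cx t)) - (LINT t:I|lborel. h0 t * q x (L t)) / (real m + 1))"
      unfolding \<Delta>_eq using iq[of x]
      by (simp add: set_integral_diff(2) set_integral_diff(1) set_integrable_divide set_integral_divide_zero)
    ultimately show ?thesis using q\<Sigma> by simp
  qed
  have \<Delta>_nonneg: "0 \<le> \<Delta> x t" if "t \<in> I" for x t
    using risk_set.information_loss(1)[OF rs[OF that], of x]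
    unfolding \<Delta>_def q_def Cx_def L_def W_def by simp
  have h\<Delta>_nonneg: "0 \<le> indicator I t *\<^sub>R (h0 t * \<Delta> x t)" for x t
    using hb[of t] \<Delta>_nonneg[of t x] by (auto simp: indicator_def)
  have le: "x \<bullet> (\<Sigma>\<^sub>P *v x) \<le> x \<bullet> (\<Sigma> *v x)" for x
  proof -
    have "0 \<le> (LINT t:I|lborel. h0 t * \<Delta> x t)"
      unfolding set_lebesgue_integral_def by (rule integral_nonneg_AE, rule AE_I2, rule h\<Delta>_nonneg)
    then show ?thesis using gap[of x] by (simp add: q_def)
  qed

  have "\<beta> = 0" if "matrix_inv \<Sigma>\<^sub>P = matrix_inv \<Sigma>"
  proof (rule ccontr)
    assume "\<beta> \<noteq> 0"
    have "\<Sigma>\<^sub>P = \<Sigma>" by (rule pos_def_matrix_inv_inject[OF iv that])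
    then have "integral\<^sup>L lborel (\<lambda>t. indicator I t *\<^sub>R (h0 t * \<Delta> \<beta> t)) = 0"
      using gap[of \<beta>] by (simp add: set_lebesgue_integral_def)
    then have "AE t in lborel. indicator I t *\<^sub>R (h0 t * \<Delta> \<beta> t) = 0"
      using integral_nonneg_eq_0_iff_AE[OF i\<Delta>[unfolded set_integrable_def] AE_I2[OF h\<Delta>_nonneg]] by simp
    then have "AE t in lborel. indicator I t *\<^sub>R (h0 t * q \<beta> (W t)) = 0"
    proof eventually_elim
      case (elim t)
      show ?case
      proof (cases "t \<in> I")
        case True
        \<comment> \<open>The positive lower bound \<open>a\<close> on the hazard allows it to be
          cancelled.\<close>
        then have "\<Delta> \<beta> t = 0" using elim ab[OF True] a by auto
        then have "q \<beta> (W t) = 0"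
          unfolding \<Delta>_def q_def Cx_def L_def W_def
          by (intro risk_set.information_loss(2)[OF rs[OF True]]) simp
        then show ?thesis by simp
      qed simp
    qed
    then have "q \<beta> \<Sigma> = 0"
      unfolding q\<Sigma> set_lebesgue_integral_def by (rule integral_eq_zero_AE)
    then show False using iv(2) \<open>\<beta> \<noteq> 0\<close> unfolding pos_def_def q_def by auto
  qed
  moreover have "matrix_inv \<Sigma>\<^sub>P = matrix_inv \<Sigma>" if "\<beta> = 0"
  proof -
    have "x \<bullet> (\<Sigma>\<^sub>P *v x) = x \<bullet> (\<Sigma> *v x)" for x
    proof -
      have "\<Delta> x t = 0" if "t \<in> I" for t
        using risk_set.information_loss(3)[OF rs[OF that] \<open>\<beta> = 0\<close>, of x]
        unfolding \<Delta>_def q_def Cx_def L_def W_def by simp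
      then have "indicator I t *\<^sub>R (h0 t * \<Delta> x t) = 0" for t
        by (simp add: indicator_def)
      then have "(LINT t:I|lborel. h0 t * \<Delta> x t) = 0"
        unfolding set_lebesgue_integral_def by (simp only: integral_zero)
      then show ?thesis using gap[of x] by (simp add: q_def)
    qed
    then show ?thesis
      using iv symmetric_matrix_eqI[of \<Sigma>\<^sub>P \<Sigma>] unfolding pos_def_def by simp
  qed
  ultimately show ?thesis using nonneg_def_diff_matrix_inv[OF iv le] by blast
qed

end
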